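(* Let $n\ge 5$ be odd, $m=\frac{2^n+1}{3}$ and $g=\frac{9m-7}{2}$. Let $\rho_\ell\in H(P_\infty)$ be such that $\rho_\ell>2g$ and $\rho_{\ell+1}=(0,1,k)=2m+8k<4g$ for an integer $k\in[m,2m)$. Then $$d_{ORD}(C_\ell(P_\infty))=\begin{cases}\nu_{\ell+5}=8k-7m+13, & \text{if } k<\frac{9m-11}{8},\\ \nu_{\ell+3}=8k-7m+11, & \text{if } \frac{9m-11}{8}\le k<\frac{11m-9}{8},\\ \nu_{\ell+1}=8k-7m+9, & \text{if } k\ge\frac{11m-9}{8}.\end{cases}$$
   Context: Let $n\ge5$ be odd, $m=(2^n+1)/3$, and let $GGS(2,n)$ be (the nonsingular model of) the curve $X^2+X=Y^{3}$, $Y^{4}-Y=Z^m$; it is $\mathbb F_{2^{2n}}$-maximal of genus $g=\frac{9m-7}{2}$ and has a unique point at infinity $P_\infty$. The Weierstrass semigroup $H(P_\infty)$ (the set of $r\ge 0$ such that some rational function has pole divisor $rP_\infty$) is known to be $$H(P_\infty)=\{3im+2jm+8k \mid i\in\{0,1\},\ j\in\{0,1,2,3\},\ k\ge0\},$$ and each element has a unique such representation; $(i,j,k)$ denotes the element $3im+2jm+8k$. Write $H(P_\infty)=\{\rho_1=0<\rho_2<\rho_3<\cdots\}$. For $\ell\ge1$, $\nu_\ell$ is the number of ordered pairs $(a,b)\in H(P_\infty)\times H(P_\infty)$ with $a+b=\rho_{\ell+1}$. Let $\overline D$ be the sum of all $\mathbb F_{2^{2n}}$-rational points other than $P_\infty$,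 and $C_\ell(P_\infty)=C^\perp(\overline D,\rho_\ell P_\infty)$ the dual of the one-point AG code obtained by evaluating $\mathcal L(\rho_\ell P_\infty)$ at the points of $\overline D$. The order bound (Feng-Rao designed minimum distance) is $d_{ORD}(C_\ell(P_\infty))=\min\{\nu_r\mid r\ge\ell\}$. *)

theory Defs
  imports
    "HOL-Algebra.Algebraic_Closure_Type"
    "HOL-Algebra.Generated_Fields"
    "HOL-Algebra.Finite_Extensions"
    "HOL-Library.Infinite_Set"
begin

text \<open>
  A function field \<open>F/K\<close> is given by a type \<open>'a\<close> of class \<open>field\<close> (the field \<open>F\<close>) together with
  a subset \<open>K\<close> (the constant field).  The notions of HOL-Algebra are applied to the record
  \<open>ring_of_type_algebra\<close> of this type.
\<close>

abbreviation fld :: "'a::field ring" where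
  "fld \<equiv> ring_of_type_algebra"

text \<open>
  The function field of the curve \<open>X\<^sup>2 + X = Y\<^sup>3\<close>, \<open>Y\<^sup>4 - Y = Z\<^sup>m\<close> over the field \<open>K\<close> with
  \<open>2\<^sup>2\<^sup>n\<close> elements, with coordinate functions \<open>x, y, z\<close>, i.e. \<open>(x, y, z)\<close> is a generic point.
  Transcendence of \<open>z\<close> says that \<open>F/K\<close> is a function field (of one variable) at all.
  As \<open>m\<close> is odd, the pole of \<open>z\<close> is totally ramified in \<open>K(x,y,z)/K(z)\<close>; hence this extension has
  degree 8, the equations define an irreducible curve, and \<open>F\<close> is determined up to
  isomorphism over \<open>K\<close>.
\<close>

definition GGS_function_field ::
    "nat \<Rightarrow> nat \<Rightarrow> 'a::field set \<Rightarrow> 'a \<Rightarrow> 'a \<Rightarrow> 'a \<Rightarrow> bool" where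
  "GGS_function_field n m K x y z \<longleftrightarrow>
     subfield K fld \<and> finite K \<and> card K = 2 ^ (2 * n) \<and>
     x ^ 2 + x = y ^ 3 \<and> y ^ 4 - y = z ^ m \<and>
     ring.transcendental fld K z \<and>
     generate_field fld (K \<union> {x, y, z}) = UNIV"

text \<open>
  A place of \<open>F/K\<close>, i.e. a point of the nonsingular model, is represented by its valuation ring:
  a ring \<open>P\<close> with \<open>K \<subset> P \<subset> F\<close>, both inclusions strict, containing \<open>f\<close> or \<open>1/f\<close> for every
  nonzero \<open>f\<close>.
\<close>

definition places :: "'a::field set \<Rightarrow> 'a set set" where
  "places K = {P. subring P fld \<and> K \<subset> P \<and> P \<subset> UNIV \<and> (\<forall>f. f \<noteq> 0 \<longrightarrow> f \<in> P \<or> inverse f \<in> P)}"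

definition place_units :: "'a::field set \<Rightarrow> 'a set" where
  "place_units P = {f. f \<noteq> 0 \<and> f \<in> P \<and> inverse f \<in> P}"

definition is_uniformizer :: "'a::field set \<Rightarrow> 'a \<Rightarrow> bool" where
  "is_uniformizer P t \<longleftrightarrow> P - place_units P = {t * h | h. h \<in> P}"

text \<open>The discrete valuation at \<open>P\<close>; meaningful for nonzero \<open>f\<close> only.\<close>

definition place_ord :: "'a::field set \<Rightarrow> 'a \<Rightarrow> int" where
  "place_ord P f =
     (THE i. \<exists>t u. is_uniformizer P t \<and> u \<in> place_units P \<and> f = (t powi i) * u)"

text \<open>
  The pole divisor of \<open>f\<close> is \<open>rP\<close>: the pole order at \<open>P\<close> is \<open>r\<close>, and \<open>f\<close> has no pole at (lies in
  the valuation ring of) any other place.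
\<close>

definition has_pole_divisor :: "'a::field set \<Rightarrow> 'a \<Rightarrow> nat \<Rightarrow> 'a set \<Rightarrow> bool" where
  "has_pole_divisor K f r P \<longleftrightarrow>
     f \<noteq> 0 \<and> nat (- place_ord P f) = r \<and> (\<forall>Q \<in> places K. Q \<noteq> P \<longrightarrow> f \<in> Q)"

definition weierstrass_semigroup :: "'a::field set \<Rightarrow> 'a set \<Rightarrow> nat set" where
  "weierstrass_semigroup K P = {r. \<exists>f. has_pole_divisor K f r P}"

definition place_at_infinity ::
    "'a::field set \<Rightarrow> 'a \<Rightarrow> 'a \<Rightarrow> 'a \<Rightarrow> 'a set \<Rightarrow> bool" where
  "place_at_infinity K x y z P \<longleftrightarrow> P \<in> places K \<and> \<not> {x, y, z} \<subseteq> P"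

text \<open>
  The increasing enumeration \<open>\<rho>\<^sub>1 < \<rho>\<^sub>2 < \<dots>\<close> of an infinite set starts at index 1, whereas
  \<open>enumerate\<close> starts at 0.
\<close>

definition rho :: "nat set \<Rightarrow> nat \<Rightarrow> nat" where
  "rho H l = enumerate H (l - 1)"

definition nu :: "nat set \<Rightarrow> nat \<Rightarrow> nat" where
  "nu H l = card {(a, b). a \<in> H \<and> b \<in> H \<and> a + b = rho H (l + 1)}"

text \<open>
  The order (Feng-Rao) bound \<open>d\<^sub>O\<^sub>R\<^sub>D(C\<^sub>l(P))\<close> of the dual \<open>C\<^sub>l(P)\<close> of the one-point code of
  \<open>\<L>(\<rho>\<^sub>l P)\<close>.  It depends on the code only through the Weierstrass semigroup \<open>H\<close> of \<open>P\<close> and the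
  index \<open>l\<close>.  The infimum of a nonempty set of natural numbers is its minimum.
\<close>

definition d_ORD :: "nat set \<Rightarrow> nat \<Rightarrow> nat" where
  "d_ORD H l = Inf {nu H r | r. r \<ge> l}"

end

theory Submission
  imports Defs
begin

text \<open>
  With \<open>s = y\<^sup>2 + y\<close> one has \<open>s\<^sup>2 + s = z\<^sup>m\<close>, so the
  function field is a tower of three Artin-Schreier extensions \<open>w\<^sup>2 + w = c\<close> of \<open>K(z)\<close>, with \<open>w\<close> equal
  to \<open>s\<close>, \<open>y\<close>, \<open>x\<close>.  These have pole orders \<open>4m, 2m, 3m\<close> at infinity, while \<open>z\<close> has pole order 8; as \<open>m\<close>
  is odd, the terms of \<open>f = \<Sum> a(z) s\<^sup>h y\<^sup>j x\<^sup>i\<close> have distinct pole orders, so that the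
  valuation of \<open>f\<close> can be read off and there is only one place at infinity.  A function with poles only there lies
  in all valuation rings above \<open>K[z]\<close>, hence is integral over \<open>K[z]\<close>; each step of the tower has
  discriminant 1, so the coefficients \<open>a(z)\<close> are then integral, i.e. polynomials.

  Since \<open>m\<close> is 3 modulo 8, the semigroup is described by the least element in each residue class modulo 8.
  This gives the number of decompositions of \<open>8w + \<rho>\<close> as a sum of eight truncated linear
  functions of \<open>w\<close>, and the minimum is found by linear arithmetic in each class \<open>\<rho>\<close>.
\<close>

section \<open>Subrings of a field and polynomials over them\<close>

lemma subring_fld_iff:
  "subring S fld \<longleftrightarrow> 1 \<in> S \<and> (\<forall>a\<in>S. \<forall>b\<in>S. a - b \<in> S \<and> a * b \<in> (S::'a::field set))"
proof -
  interpret F: Ring.field "fld :: 'a ring" by (rule field_from_type_algebra)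
  have neg: "\<ominus>\<^bsub>fld\<^esub> a = - a" for a :: 'a
  proof -
    have "a \<oplus>\<^bsub>fld\<^esub> (- a) = \<zero>\<^bsub>fld\<^esub>" "a \<in> carrier fld" "- a \<in> carrier fld"
      by (auto simp: ring_of_type_algebra_def)
    then show ?thesis by (metis F.minus_equality F.add.m_comm)
  qed
  show ?thesis
  proof
    assume S: "subring S fld"
    show "1 \<in> S \<and> (\<forall>a\<in>S. \<forall>b\<in>S. a - b \<in> S \<and> a * b \<in> S)"
    proof (intro conjI ballI)
      show "1 \<in> S" using subringE(3)[OF S] by (simp add: ring_of_type_algebra_def)
      fix a b assume ab: "a \<in> S" "b \<in> S"
      show "a * b \<in> S" using subringE(6)[OF S ab] by (simp add: ring_of_type_algebra_def)
      have "- b \<in> S" using subringE(5)[OF S ab(2)] by (simp add: neg)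
      then show "a - b \<in> S" using subringE(7)[OF S ab(1)] by (fastforce simp: ring_of_type_algebra_def)
    qed
  next
    assume *: "1 \<in> S \<and> (\<forall>a\<in>S. \<forall>b\<in>S. a - b \<in> S \<and> a * b \<in> S)"
    then have 0: "0 \<in> S" by force
    have m: "- a \<in> S" if "a \<in> S" for a using * 0 that by (metis diff_0)
    show "subring S fld"
    proof (rule F.subringI)
      fix a b assume ab: "a \<in> S" "b \<in> S"
      show "\<ominus>\<^bsub>fld\<^esub> a \<in> S" using m ab by (simp add: neg)
      have "a + b = a - (- b)" by simp
      also have "\<dots> \<in> S" using * ab m by blast
      finally show "a \<oplus>\<^bsub>fld\<^esub> b \<in> S" by (simp add: ring_of_type_algebra_def)
    qed (use * in \<open>auto simp: ring_of_type_algebra_def\<close>)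
  qed
qed

lemma inv_fld: "a \<noteq> 0 \<Longrightarrow> inv\<^bsub>fld\<^esub> a = inverse (a::'a::field)"
proof -
  interpret F: Ring.field "fld :: 'a ring" by (rule field_from_type_algebra)
  show "a \<noteq> 0 \<Longrightarrow> ?thesis"
    by (rule F.comm_inv_char) (auto simp: ring_of_type_algebra_def)
qed

lemma subfield_fld_iff:
  "subfield S fld \<longleftrightarrow> subring S fld \<and> (\<forall>a\<in>S. inverse a \<in> (S::'a::field set))"
proof -
  interpret F: Ring.field "fld :: 'a ring" by (rule field_from_type_algebra)
  have z: "\<zero>\<^bsub>fld\<^esub> = (0::'a)" by (simp add: ring_of_type_algebra_def)
  show ?thesis
  proof
    assume S: "subfield S fld"
    then have R: "subring S fld" by (simp add: subfieldE(1))
    moreover have "inverse a \<in> S" if "a \<in> S" for a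
      using F.subfield_m_inv(1)[OF S, of a] that inv_fld[of a] z by (cases "a = 0") auto
    ultimately show "subring S fld \<and> (\<forall>a\<in>S. inverse a \<in> S)" by blast
  next
    assume "subring S fld \<and> (\<forall>a\<in>S. inverse a \<in> S)"
    then show "subfield S fld"
      by (intro F.subfieldI') (auto simp: z inv_fld)
  qed
qed

lemma subringD:
  assumes "subring S fld"
  shows subring_1: "1 \<in> S" and subring_0: "0 \<in> (S::'a::field set)"
    and subring_diff: "\<And>a b. a \<in> S \<Longrightarrow> b \<in> S \<Longrightarrow> a - b \<in> S"
    and subring_mult: "\<And>a b. a \<in> S \<Longrightarrow> b \<in> S \<Longrightarrow> a * b \<in> S"
    and subring_uminus: "\<And>a. a \<in> S \<Longrightarrow> - a \<in> S"
    and subring_add: "\<And>a b. a \<in> S \<Longrightarrow> b \<in> S \<Longrightarrow> a + b \<in> S"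
proof -
  show 1: "1 \<in> S" and d: "\<And>a b. a \<in> S \<Longrightarrow> b \<in> S \<Longrightarrow> a - b \<in> S"
    and "\<And>a b. a \<in> S \<Longrightarrow> b \<in> S \<Longrightarrow> a * b \<in> S"
    using assms by (auto simp: subring_fld_iff)
  show 0: "0 \<in> S" using d[OF 1 1] by simp
  show m: "- a \<in> S" if "a \<in> S" for a using d[OF 0 that] by simp
  show "a + b \<in> S" if "a \<in> S" "b \<in> S" for a b using d[OF that(1) m[OF that(2)]] by simp
qed

lemma subring_power: "subring S fld \<Longrightarrow> a \<in> S \<Longrightarrow> a ^ n \<in> (S::'a::field set)"
  by (induction n) (auto simp: subring_1 subring_mult)

lemma subring_sum:
  "subring S fld \<Longrightarrow> (\<And>i. i \<in> I \<Longrightarrow> f i \<in> S) \<Longrightarrow> sum f I \<in> (S::'a::field set)"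
  by (induction I rule: infinite_finite_induct) (auto simp: subring_0 subring_add)

lemma subring_Union_chain:
  assumes "C \<noteq> {}" and "\<And>S. S \<in> C \<Longrightarrow> subring S fld"
    and "\<And>S T. S \<in> C \<Longrightarrow> T \<in> C \<Longrightarrow> S \<subseteq> T \<or> T \<subseteq> S"
  shows "subring (\<Union>C :: 'a::field set) fld"
  unfolding subring_fld_iff
proof (intro conjI ballI)
  show "1 \<in> \<Union>C" using assms(1,2) subring_1 by blast
  fix a b assume "a \<in> \<Union>C" "b \<in> \<Union>C"
  then obtain S where "S \<in> C" "a \<in> S" "b \<in> S" using assms(3) by blast
  then show "a - b \<in> \<Union>C" "a * b \<in> \<Union>C"
    using assms(2) subring_diff subring_mult by blast+
qed

section \<open>Polynomials with coefficients in a subring, and rings generated by one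
  element\<close>

definition polys_over :: "'a::field set \<Rightarrow> 'a poly set" where
  "polys_over S = {p. \<forall>i. poly.coeff p i \<in> S}"

definition adjoin :: "'a::field set \<Rightarrow> 'a \<Rightarrow> 'a set" where
  "adjoin S h = (\<lambda>p. poly p h) ` polys_over S"

context
  fixes S :: "'a::field set"
  assumes S: "subring S fld"
begin

lemma polys_over_0: "0 \<in> polys_over S"
  by (simp add: polys_over_def subring_0[OF S])

lemma polys_over_pCons: "pCons a p \<in> polys_over S \<longleftrightarrow> a \<in> S \<and> p \<in> polys_over S"
  by (force simp: polys_over_def coeff_pCons split: nat.splits)

lemma polys_over_add: "p \<in> polys_over S \<Longrightarrow> q \<in> polys_over S \<Longrightarrow> p + q \<in> polys_over S"
  by (simp add: polys_over_def subring_add[OF S])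

lemma polys_over_diff: "p \<in> polys_over S \<Longrightarrow> q \<in> polys_over S \<Longrightarrow> p - q \<in> polys_over S"
  by (simp add: polys_over_def subring_diff[OF S])

lemma polys_over_mult: "p \<in> polys_over S \<Longrightarrow> q \<in> polys_over S \<Longrightarrow> p * q \<in> polys_over S"
  by (simp add: polys_over_def coeff_mult subring_sum[OF S] subring_mult[OF S])

lemma polys_over_monom: "a \<in> S \<Longrightarrow> Polynomial.monom a n \<in> polys_over S"
  by (simp add: polys_over_def subring_0[OF S])

lemma polys_over_reflect: "p \<in> polys_over S \<Longrightarrow> reflect_poly p \<in> polys_over S"
  by (simp add: polys_over_def coeff_reflect_poly subring_0[OF S])

lemma poly_in_subring: "p \<in> polys_over S \<Longrightarrow> h \<in> S \<Longrightarrow> poly p h \<in> S"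
  by (induction p) (auto simp: polys_over_pCons subring_0[OF S] subring_add[OF S] subring_mult[OF S])

lemma subring_adjoin: "subring (adjoin S h) fld"
  unfolding subring_fld_iff
proof (intro conjI ballI)
  show "1 \<in> adjoin S h"
    unfolding adjoin_def
    by (rule image_eqI[of _ _ "[:1:]"])
       (auto simp: polys_over_pCons polys_over_0 subring_1[OF S])
  fix a b assume "a \<in> adjoin S h" "b \<in> adjoin S h"
  then obtain p q where pq: "p \<in> polys_over S" "q \<in> polys_over S" "a = poly p h" "b = poly q h"
    unfolding adjoin_def by blast
  show "a - b \<in> adjoin S h" unfolding adjoin_def
    by (rule image_eqI[of _ _ "p - q"]) (use pq in \<open>auto simp: polys_over_diff\<close>)
  show "a * b \<in> adjoin S h" unfolding adjoin_def
    by (rule image_eqI[of _ _ "p * q"]) (use pq in \<open>auto simp: polys_over_mult\<close>)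
qed

lemma adjoin_self: "h \<in> adjoin S h"
  unfolding adjoin_def
  by (rule image_eqI[of _ _ "[:0, 1:]"])
     (auto simp: polys_over_pCons polys_over_0 subring_1[OF S] subring_0[OF S])

lemma subset_adjoin: "S \<subseteq> adjoin S h"
proof
  fix a assume "a \<in> S"
  then show "a \<in> adjoin S h" unfolding adjoin_def
    by (intro image_eqI[of _ _ "[:a:]"]) (auto simp: polys_over_pCons polys_over_0)
qed

end

section \<open>Valuation rings and integral closure\<close>

text \<open>Unlike a place, such a ring may be the whole field and is not tied to \<open>K\<close>;
  integral closures are intersections of rings of this kind.\<close>

definition val_ring :: "'a::field set \<Rightarrow> bool" where
  "val_ring Q \<longleftrightarrow> subring Q fld \<and> (\<forall>f. f \<noteq> 0 \<longrightarrow> f \<in> Q \<or> inverse f \<in> Q)"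

text \<open>Otherwise \<open>inverse f\<close> lies in \<open>Q\<close>, and dividing the monic
  equation by a power of \<open>f\<close> writes \<open>f\<close> as a polynomial in
  \<open>inverse f\<close> over \<open>Q\<close>.\<close>

lemma monic_root_in_val_ring:
  assumes Q: "val_ring Q" and p: "p \<in> polys_over Q" "Polynomial.lead_coeff p = 1"
    and root: "poly p f = 0"
  shows "f \<in> (Q::'a::field set)"
proof (rule ccontr)
  assume f: "f \<notin> Q"
  have S: "subring Q fld" using Q by (simp add: val_ring_def)
  have f0: "f \<noteq> 0" using f subring_0[OF S] by auto
  then have i: "inverse f \<in> Q" using Q f by (auto simp: val_ring_def)
  obtain c r where r: "reflect_poly p = pCons c r" by (cases "reflect_poly p")
  have "c = 1" using p(2) r by (metis coeff_0_reflect_poly coeff_pCons_0)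
  have rq: "r \<in> polys_over Q"
    using polys_over_reflect[OF S p(1)] r polys_over_pCons[OF S] by simp
  have "poly (reflect_poly p) (inverse f) = 0"
    using f0 root by (simp add: poly_reflect_poly_nz)
  then have "1 + inverse f * poly r (inverse f) = 0" by (simp add: r \<open>c = 1\<close>)
  then have "f = - poly r (inverse f)"
    using f0 by (simp add: field_simps add_eq_0_iff)
  then show False
    using f subring_uminus[OF S poly_in_subring[OF S rq i]] by simp
qed

text \<open>Omitting \<open>f\<close> is inherited by unions of chains, so Zorn's lemma
  applies.\<close>

lemma maximal_subring_omitting:
  assumes B: "subring (B::'a::field set) fld" and f: "f \<notin> B"
  obtains M where "subring M fld" "B \<subseteq> M" "f \<notin> M"
    "\<And>A. subring A fld \<Longrightarrow> M \<subseteq> A \<Longrightarrow> f \<notin> A \<Longrightarrow> A = M"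
proof -
  let ?X = "{A. subring A fld \<and> B \<subseteq> A \<and> f \<notin> A}"
  have "\<exists>M\<in>?X. \<forall>A\<in>?X. M \<subseteq> A \<longrightarrow> A = M"
  proof (rule subset_Zorn_nonempty)
    show "?X \<noteq> {}" using assms by blast
    fix C assume C: "C \<noteq> {}" "subset.chain ?X C"
    have "subring (\<Union>C) fld"
      using C by (intro subring_Union_chain) (auto simp: subset_chain_def)
    moreover have "B \<subseteq> \<Union>C" "f \<notin> \<Union>C"
      using C unfolding subset_chain_def by blast+
    ultimately show "\<Union>C \<in> ?X" by blast
  qed
  then obtain M where "M \<in> ?X" "\<forall>A\<in>?X. M \<subseteq> A \<longrightarrow> A = M" by blast
  then show ?thesis using that[of M] by auto
qed

text \<open>Chevalley's extension theorem in the special case of a principal ideal: the ideal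
  generated by \<open>inverse f\<close> is proper in \<open>B\<close>, and stays so in the maximal ring.\<close>

lemma val_ring_omitting:
  assumes B: "subring (B::'a::field set) fld" and f: "f \<notin> B" "inverse f \<in> B"
  obtains Q where "val_ring Q" "B \<subseteq> Q" "f \<notin> Q"
proof -
  obtain M where S: "subring M fld" and BM: "B \<subseteq> M" and fM: "f \<notin> M"
    and max: "\<And>A. subring A fld \<Longrightarrow> M \<subseteq> A \<Longrightarrow> f \<notin> A \<Longrightarrow> A = M"
    using maximal_subring_omitting[OF B f(1)] by metis
  define g where "g = inverse f"
  have g: "g \<in> M" using BM f(2) by (auto simp: g_def)
  have f0: "f \<noteq> 0" using f(1) subring_0[OF B] by auto
  have gf: "g * f = 1" using f0 by (simp add: g_def)
  \<comment> \<open>By maximality, adjoining any element outside \<open>M\<close> already produces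
    \<open>f\<close>.\<close>
  have ex: "\<exists>p\<in>polys_over M. f = poly p h" if "h \<notin> M" for h
  proof -
    have "f \<in> adjoin M h"
      using max[OF subring_adjoin[OF S] subset_adjoin[OF S]] adjoin_self[OF S] that by metis
    then show ?thesis by (auto simp: adjoin_def)
  qed
  have pow: "\<exists>b\<in>M. (1 - g * a) ^ N = 1 - g * b" if "a \<in> M" for a N
  proof (induction N)
    case 0
    show ?case by (rule bexI[of _ 0]) (auto simp: subring_0[OF S])
  next
    case (Suc N)
    then obtain b where b: "b \<in> M" "(1 - g * a) ^ N = 1 - g * b" by blast
    have "(1 - g * a) ^ Suc N = (1 - g * a) * (1 - g * b)" by (simp add: b(2))
    also have "\<dots> = 1 - g * (a + b - g * a * b)" by (simp add: algebra_simps)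
    finally have "(1 - g * a) ^ Suc N = 1 - g * (a + b - g * a * b)" .
    moreover have "a + b - g * a * b \<in> M"
      using S that b g by (auto intro!: subring_add subring_diff subring_mult)
    ultimately show ?case by blast
  qed
  have nz: "1 - g * a \<noteq> 0" if "a \<in> M" for a
  proof
    assume "1 - g * a = 0"
    then have "g * a = g * f" using gf by simp
    then have "a = f" using gf by (metis mult_cancel_left mult_zero_left zero_neq_one)
    then show False using that fM by simp
  qed
  \<comment> \<open>\<open>g\<close> lies in the Jacobson radical of \<open>M\<close>: if the
    inverse were missing, \<open>f\<close> would be a polynomial in it. Multiplying by a power of
    \<open>1 - g * a\<close>, which by \<open>pow\<close> has the form \<open>1 - g * b\<close>,
    would then give \<open>f - b \<in> M\<close>.\<close>
  have jac: "inverse (1 - g * a) \<in> M" if a: "a \<in> M" for a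
  proof (rule ccontr)
    assume "inverse (1 - g * a) \<notin> M"
    then obtain p where p: "p \<in> polys_over M" "f = poly p (inverse (1 - g * a))"
      using ex by blast
    obtain b where b: "b \<in> M" "(1 - g * a) ^ Polynomial.degree p = 1 - g * b" using pow[OF a] by blast
    have "poly (reflect_poly p) (1 - g * a) = (1 - g * b) * f"
      using nz[OF a] p(2) b(2) by (simp add: poly_reflect_poly_nz)
    also have "\<dots> = f - b * (g * f)" by (simp add: algebra_simps)
    finally have "f = poly (reflect_poly p) (1 - g * a) + b" by (simp add: gf)
    moreover have "poly (reflect_poly p) (1 - g * a) + b \<in> M"
      using S a b g p by (auto intro!: subring_add poly_in_subring subring_diff subring_mult
          polys_over_reflect subring_1)
    ultimately show False using fM by simp
  qed
  \<comment> \<open>Degree descent: the constant term \<open>c\<close> of \<open>q\<close> is moved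
    to the left, where \<open>1 - g * c\<close> is a unit. Multiplying by \<open>g\<close> expresses
    1 through negative powers of \<open>h\<close> only; inserting this into the leading term of
    \<open>p\<close> lowers the degree.\<close>
  have reduce: "\<exists>p'\<in>polys_over M. f = poly p' h \<and> Polynomial.degree p' < Polynomial.degree p"
    if p: "f = poly p h" "p \<in> polys_over M" and q: "f = poly q (inverse h)" "q \<in> polys_over M"
      and h: "h \<noteq> 0" and le: "Polynomial.degree q \<le> Polynomial.degree p" for p q h
  proof -
    obtain c r where qr: "q = pCons c r" by (cases q)
    have c: "c \<in> M" and r: "r \<in> polys_over M" using q(2) by (simp_all add: qr polys_over_pCons[OF S])
    have "r \<noteq> 0" using q(1) c fM by (auto simp: qr)
    then have dr: "Suc (Polynomial.degree r) \<le> Polynomial.degree p" using le by (simp add: qr)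
    define u n a where "u = inverse (1 - g * c)" and "n = Polynomial.degree p" and "a = poly.coeff p n"
    have u: "u \<in> M" using jac[OF c] by (simp add: u_def)
    have a: "a \<in> M" using p(2) by (simp add: a_def polys_over_def)
    have "(1 - g * c) * f = f - c * (g * f)" by (simp add: algebra_simps)
    also have "\<dots> = poly r (inverse h) / h" using q(1) gf by (simp add: qr divide_inverse mult.commute)
    finally have *: "(1 - g * c) * f = poly r (inverse h) / h" .
    have "f = u * ((1 - g * c) * f)" using nz[OF c] by (simp add: u_def)
    then have "f = u * poly r (inverse h) / h" by (simp only: * times_divide_eq_right)
    then have one: "1 = g * u * poly r (inverse h) / h" using gf by (simp add: mult.assoc)
    define p' where "p' = (p - Polynomial.monom a n) +
      Polynomial.monom (g * u * a) (n - 1 - Polynomial.degree r) * reflect_poly r"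
    have "p' \<in> polys_over M" unfolding p'_def
      using S p(2) a u g r by (intro polys_over_add polys_over_diff polys_over_mult polys_over_monom
          polys_over_reflect subring_mult) auto
    moreover have "f = poly p' h"
    proof -
      have n: "n = Suc (n - 1 - Polynomial.degree r + Polynomial.degree r)" using dr by (simp add: n_def)
      have "a * h ^ n = a * h ^ n * (g * u * poly r (inverse h) / h)" using one by simp
      also have "\<dots> = g * u * a * h ^ (n - 1 - Polynomial.degree r) *
          (h ^ Polynomial.degree r * poly r (inverse h))"
        by (subst n) (use h in \<open>simp add: power_add field_simps\<close>)
      also have "h ^ Polynomial.degree r * poly r (inverse h) = poly (reflect_poly r) h"
        using h by (simp add: poly_reflect_poly_nz)
      finally have "poly p' h = poly p h"
        unfolding p'_def poly_add poly_diff poly_mult poly_monom by (metis diff_add_cancel)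
      then show ?thesis using p(1) by simp
    qed
    moreover have "Polynomial.degree p' < n"
    proof -
      have "Polynomial.degree (p - Polynomial.monom a n) \<le> n - 1"
        by (rule Polynomial.degree_le) (auto simp: a_def n_def coeff_eq_0 not_less Suc_le_eq le_less)
      moreover have "Polynomial.degree (Polynomial.monom (g * u * a) (n - 1 - Polynomial.degree r) * reflect_poly r)
          \<le> (n - 1 - Polynomial.degree r) + Polynomial.degree r"
        by (rule order_trans[OF degree_mult_le]) (intro add_mono degree_monom_le degree_reflect_poly_le)
      ultimately have "Polynomial.degree p' \<le> n - 1"
        unfolding p'_def using dr by (intro Polynomial.degree_add_le) (auto simp: n_def)
      then show ?thesis using dr by (simp add: n_def)
    qed
    ultimately show ?thesis by (auto simp: n_def)
  qed
  \<comment> \<open>The descent applies to the longer of the two expressions, with \<open>h\<close>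
    and \<open>inverse h\<close> exchanged if necessary, so no pair has minimal total
    degree.\<close>
  have no: False
    if "f = poly p h" "p \<in> polys_over M" "f = poly q (inverse h)" "q \<in> polys_over M" "h \<noteq> 0"
    for p q h
    using that
  proof (induction "Polynomial.degree p + Polynomial.degree q" arbitrary: p q rule: less_induct)
    case less
    show False
    proof (cases "Polynomial.degree q \<le> Polynomial.degree p")
      case True
      then obtain p' where "p' \<in> polys_over M" "f = poly p' h" "Polynomial.degree p' < Polynomial.degree p"
        using reduce[OF less.prems] by blast
      then show False using less.hyps[of p' q] less.prems by simp
    next
      case False
      then obtain q' where "q' \<in> polys_over M" "f = poly q' (inverse h)"
          "Polynomial.degree q' < Polynomial.degree q"
        using reduce[of q "inverse h" p] less.prems by auto
      then show False using less.hyps[of p q'] less.prems by simp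
    qed
  qed
  have "val_ring M"
    unfolding val_ring_def
  proof (intro conjI allI impI S)
    fix h :: 'a assume h: "h \<noteq> 0"
    show "h \<in> M \<or> inverse h \<in> M"
      using no[OF _ _ _ _ h] ex[of h] ex[of "inverse h"] by blast
  qed
  then show ?thesis using that BM fM by blast
qed

text \<open>As an intersection of valuation rings it is visibly a ring and fits conditions on poles;
  \<open>integral_closure_iff\<close> identifies it with the usual notion.\<close>

definition integral_closure :: "'a::field set \<Rightarrow> 'a set" where
  "integral_closure A = {f. \<forall>Q. val_ring Q \<longrightarrow> A \<subseteq> Q \<longrightarrow> f \<in> Q}"

lemma polys_over_mono: "A \<subseteq> B \<Longrightarrow> polys_over A \<subseteq> polys_over B"
  by (auto simp: polys_over_def)

lemma val_ring_subring: "val_ring Q \<Longrightarrow> subring Q fld"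
  by (simp add: val_ring_def)

text \<open>If \<open>f\<close> were not a polynomial in \<open>inverse f\<close> over
  \<open>A\<close>, some valuation ring above \<open>A\<close> would omit \<open>f\<close>. Clearing
  denominators in such an expression gives a monic equation.\<close>

lemma integral_closure_iff:
  assumes A: "subring (A::'a::field set) fld"
  shows "f \<in> integral_closure A \<longleftrightarrow>
    (\<exists>p\<in>polys_over A. Polynomial.lead_coeff p = 1 \<and> poly p f = 0)"
proof
  assume f: "f \<in> integral_closure A"
  show "\<exists>p\<in>polys_over A. Polynomial.lead_coeff p = 1 \<and> poly p f = 0"
  proof (cases "f = 0")
    case True
    then show ?thesis
      by (intro bexI[of _ "[:0, 1:]"])
         (auto simp: polys_over_pCons[OF A] polys_over_0[OF A] subring_0[OF A] subring_1[OF A])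
  next
    case False
    have "f \<in> adjoin A (inverse f)"
    proof (rule ccontr)
      assume "f \<notin> adjoin A (inverse f)"
      then obtain Q where "val_ring Q" "adjoin A (inverse f) \<subseteq> Q" "f \<notin> Q"
        using val_ring_omitting[OF subring_adjoin[OF A]] adjoin_self[OF A] by metis
      then show False
        using f subset_adjoin[OF A, of "inverse f"] unfolding integral_closure_def by blast
    qed
    then obtain p where p: "p \<in> polys_over A" "f = poly p (inverse f)"
      by (auto simp: adjoin_def)
    \<comment> \<open>\<open>q\<close> is \<open>1 - T * p(T)\<close>, which vanishes at
      \<open>inverse f\<close>; its constant term 1 becomes the leading coefficient of the reflected
      polynomial.\<close>
    define q where "q = pCons 1 (- p)"
    have q: "q \<in> polys_over A"
      using polys_over_diff[OF A polys_over_0[OF A] p(1)]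
      by (simp add: q_def polys_over_pCons[OF A] subring_1[OF A])
    have "poly q (inverse f) = 0" using p(2)[symmetric] False by (simp add: q_def)
    then have "poly (reflect_poly q) f = 0"
      using False poly_reflect_poly_nz[of f q] by simp
    moreover have "Polynomial.lead_coeff (reflect_poly q) = 1"
      by (simp add: q_def coeff_reflect_poly)
    ultimately show ?thesis using polys_over_reflect[OF A q] by blast
  qed
next
  assume "\<exists>p\<in>polys_over A. Polynomial.lead_coeff p = 1 \<and> poly p f = 0"
  then show "f \<in> integral_closure A"
    using monic_root_in_val_ring polys_over_mono unfolding integral_closure_def by blast
qed

lemma subring_integral_closure: "subring (integral_closure (A::'a::field set)) fld"
  unfolding subring_fld_iff integral_closure_def
  by (blast intro: subring_1 subring_diff subring_mult val_ring_subring)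

lemma subset_integral_closure: "A \<subseteq> integral_closure A"
  by (auto simp: integral_closure_def)

section \<open>Artin-Schreier extensions\<close>

definition span2 :: "'a::field \<Rightarrow> 'a set \<Rightarrow> 'a set" where
  "span2 w A = {a + b * w | a b. a \<in> A \<and> b \<in> A}"

lemma span2I: "a \<in> A \<Longrightarrow> b \<in> A \<Longrightarrow> a + b * w \<in> span2 w A"
  by (auto simp: span2_def)

lemma span2_mono: "A \<subseteq> B \<Longrightarrow> span2 w A \<subseteq> span2 w B"
  by (auto simp: span2_def)

lemma subset_span2: "subring A fld \<Longrightarrow> A \<subseteq> span2 w A"
  using span2I[of _ A 0 w] by (auto simp: subring_0)

lemma self_in_span2: "subring A fld \<Longrightarrow> w \<in> span2 w A"
  using span2I[of 0 A 1 w] by (auto simp: subring_0 subring_1)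

lemma subfield_subring: "subfield E fld \<Longrightarrow> subring (E::'a::field set) fld"
  by (simp add: subfield_fld_iff)

context
  fixes E :: "'a::field set" and w :: 'a
  assumes E: "subfield E fld" and w2: "w\<^sup>2 + w \<in> E" and w: "w \<notin> E"
begin

lemma span2_eq_0:
  assumes "a \<in> E" "b \<in> E" "a + b * w = 0"
  shows "a = 0 \<and> b = 0"
proof (cases "b = 0")
  case False
  then have "w = - a * inverse b" using assms(3) by (simp add: field_simps add_eq_0_iff)
  moreover have "inverse b \<in> E" using E assms(2) by (simp add: subfield_fld_iff)
  ultimately have "w \<in> E" using subfield_subring[OF E] assms(1) by (metis subring_mult subring_uminus)
  then show ?thesis using w by blast
qed (use assms in simp)

lemma subfield_span2: "subfield (span2 w E) fld"
proof -
  note R = subfield_subring[OF E]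
  define c where "c = w\<^sup>2 + w"
  have c: "c \<in> E" using w2 by (simp add: c_def)
  have ww: "w * w = c - w" by (simp add: c_def power2_eq_square)
  show ?thesis
    unfolding subfield_fld_iff subring_fld_iff
  proof (intro conjI ballI)
    show "1 \<in> span2 w E" using subset_span2[OF R] subring_1[OF R] by blast
    fix f assume "f \<in> span2 w E"
    then obtain a b where ab: "a \<in> E" "b \<in> E" "f = a + b * w" by (auto simp: span2_def)
    show "inverse f \<in> span2 w E"
    proof (cases "f = 0")
      case True
      then show ?thesis using subset_span2[OF R] subring_0[OF R] by auto
    next
      case False
      \<comment> \<open>The norm of \<open>f\<close>, that is, its product with the conjugate
        \<open>a + b * (- 1 - w)\<close>.\<close>
      define N where "N = a * a - a * b - b * b * c"
      have f': "(a - b) + (- b) * w \<noteq> 0"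
        using span2_eq_0[of "a - b" "- b"] ab False R
        by (auto simp: subring_diff subring_uminus)
      have "f * ((a - b) + (- b) * w) = a * a - a * b - b * b * (w * w + w)"
        by (simp add: ab(3) algebra_simps)
      also have "\<dots> = N" by (simp add: N_def ww)
      finally have N: "f * ((a - b) + (- b) * w) = N" .
      then have "N \<noteq> 0" using False f' by auto
      have "N \<in> E" using ab c R by (auto simp: N_def intro!: subring_diff subring_mult)
      then have "inverse N \<in> E" using E by (simp add: subfield_fld_iff)
      moreover have "inverse f = (a - b) * inverse N + (- b * inverse N) * w"
      proof -
        have "inverse f = ((a - b) + (- b) * w) * inverse N"
          using N \<open>N \<noteq> 0\<close> False by (simp add: field_simps)
        then show ?thesis by (simp add: algebra_simps)
      qed
      ultimately show ?thesis
        using ab R by (simp only:) (intro span2I subring_mult subring_diff subring_uminus)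
    qed
    fix g assume "g \<in> span2 w E"
    then obtain a' b' where ab': "a' \<in> E" "b' \<in> E" "g = a' + b' * w" by (auto simp: span2_def)
    have "f - g = (a - a') + (b - b') * w" by (simp add: ab ab' algebra_simps)
    then show "f - g \<in> span2 w E"
      using ab ab' R by (simp only:) (intro span2I subring_diff)
    have "f * g = a * a' + (a * b' + b * a') * w + b * b' * (w * w)" by (simp add: ab ab' algebra_simps)
    also have "\<dots> = (a * a' + b * b' * c) + (a * b' + b * a' - b * b') * w"
      by (simp add: ww algebra_simps)
    finally show "f * g \<in> span2 w E"
      using ab ab' c R by (simp only:) (intro span2I subring_diff subring_add subring_mult)
  qed
qed

text \<open>The conjugate of \<open>w\<close> over \<open>E\<close> is \<open>- 1 - w\<close>.\<close>

lemma poly_conjugate: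
  assumes "p \<in> polys_over E" "a \<in> E" "b \<in> E"
  shows "\<exists>a'\<in>E. \<exists>b'\<in>E. poly p (a + b * w) = a' + b' * w \<and>
    poly p (a + b * (- 1 - w)) = a' + b' * (- 1 - w)"
  using assms(1)
proof (induction p)
  case 0
  show ?case using subring_0[OF subfield_subring[OF E]] by (intro bexI[of _ 0]) auto
next
  case (pCons p0 p)
  note R = subfield_subring[OF E]
  define c where "c = w\<^sup>2 + w"
  have c: "c \<in> E" using w2 by (simp add: c_def)
  have p0: "p0 \<in> E" using pCons.prems by (simp add: polys_over_pCons[OF R])
  obtain a' b' where ab': "a' \<in> E" "b' \<in> E" "poly p (a + b * w) = a' + b' * w"
      "poly p (a + b * (- 1 - w)) = a' + b' * (- 1 - w)"
    using pCons by (auto simp: polys_over_pCons[OF R])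
  \<comment> \<open>Both roots \<open>v\<close> of \<open>v * v + v = c\<close> obey the same Horner
    step, so one pair of coordinates serves \<open>w\<close> and its conjugate.\<close>
  have *: "poly (pCons p0 p) (a + b * v) = (p0 + a * a' + b * b' * c) + (a * b' + b * a' - b * b') * v"
    if "poly p (a + b * v) = a' + b' * v" "v * v = c - v" for v
  proof -
    have "poly (pCons p0 p) (a + b * v) = p0 + a * a' + (a * b' + b * a') * v + b * b' * (v * v)"
      by (simp add: that(1) algebra_simps)
    then show ?thesis by (simp add: that(2) algebra_simps)
  qed
  show ?case
  proof (intro bexI conjI)
    show "poly (pCons p0 p) (a + b * w) = (p0 + a * a' + b * b' * c) + (a * b' + b * a' - b * b') * w"
      by (rule *[OF ab'(3)]) (simp add: c_def power2_eq_square)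
    show "poly (pCons p0 p) (a + b * (- 1 - w)) =
        (p0 + a * a' + b * b' * c) + (a * b' + b * a' - b * b') * (- 1 - w)"
      by (rule *[OF ab'(4)]) (simp add: c_def power2_eq_square algebra_simps)
  qed (use assms(2,3) ab' p0 c R in \<open>auto intro!: subring_add subring_diff subring_mult\<close>)
qed

text \<open>The discriminant of the basis \<open>1, w\<close> is \<open>(2 * w + 1)\<^sup>2 = 1\<close>, so integral elements have
  integral coordinates.\<close>

lemma integral_closure_span2:
  assumes char2: "(2::'a) = 0" and A: "subring A fld" "A \<subseteq> E"
    and wA: "w \<in> integral_closure A"
  shows "integral_closure A \<inter> span2 w E \<subseteq> span2 w (integral_closure A \<inter> E)"
proof
  fix f assume f: "f \<in> integral_closure A \<inter> span2 w E"
  then obtain a b where ab: "a \<in> E" "b \<in> E" "f = a + b * w" by (auto simp: span2_def)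
  let ?C = "integral_closure A"
  obtain p where p: "p \<in> polys_over A" "Polynomial.lead_coeff p = 1" "poly p f = 0"
    using f integral_closure_iff[OF A(1)] by blast
  have "p \<in> polys_over E" using p(1) polys_over_mono[OF A(2)] by blast
  then obtain a' b' where ab': "a' \<in> E" "b' \<in> E" "poly p (a + b * w) = a' + b' * w"
    "poly p (a + b * (- 1 - w)) = a' + b' * (- 1 - w)"
    using poly_conjugate ab(1,2) by blast
  then have "poly p (a + b * (- 1 - w)) = 0"
    using p(3) span2_eq_0[of a' b'] ab(3) by simp
  then have conj: "a + b * (- 1 - w) \<in> ?C"
    using p integral_closure_iff[OF A(1)] by blast
  \<comment> \<open>In characteristic 2 an element and its conjugate differ exactly by the
    coordinate \<open>b\<close>.\<close>
  have "f - (a + b * (- 1 - w)) = b + 2 * (b * w)" by (simp add: ab(3) algebra_simps)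
  then have b: "b \<in> ?C" using subring_diff[OF subring_integral_closure _ conj, of f] f char2 by simp
  have "a = f - b * w" by (simp add: ab)
  then have a: "a \<in> ?C"
    using subring_diff[OF subring_integral_closure _ subring_mult[OF subring_integral_closure b wA], of f] f
    by simp
  show "f \<in> span2 w (?C \<inter> E)" unfolding ab(3) using a b ab by (intro span2I) auto
qed

end

section \<open>Pole orders with respect to a common uniformizer\<close>

lemma place_units_mult:
  "val_ring Q \<Longrightarrow> f \<in> place_units Q \<Longrightarrow> g \<in> place_units Q \<Longrightarrow> f * g \<in> place_units Q"
  by (simp add: place_units_def subring_mult[OF val_ring_subring])

lemma place_units_inverse: "f \<in> place_units Q \<Longrightarrow> inverse f \<in> place_units Q"
  by (auto simp: place_units_def)

text \<open>\<open>f\<close> is a root of the monic polynomial \<open>T ^ n - f ^ n\<close> over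
  \<open>Q\<close>.\<close>

lemma power_in_val_ring:
  assumes Q: "val_ring Q" and n: "0 < n" and f: "f ^ n \<in> Q"
  shows "f \<in> Q"
proof (rule monic_root_in_val_ring[OF Q])
  note S = val_ring_subring[OF Q]
  let ?p = "Polynomial.monom 1 n - [:f ^ n:]"
  show "?p \<in> polys_over Q"
    using f S by (intro polys_over_diff polys_over_monom) (auto simp: polys_over_pCons polys_over_0 subring_1)
  have "Polynomial.degree ?p = n"
  proof (rule antisym)
    show "Polynomial.degree ?p \<le> n"
      by (intro Polynomial.degree_diff_le) (auto simp: degree_monom_le)
    show "n \<le> Polynomial.degree ?p"
      using n by (intro Polynomial.le_degree) (auto simp: coeff_pCons split: nat.splits)
  qed
  then show "Polynomial.lead_coeff ?p = 1" using n by (auto simp: coeff_pCons split: nat.splits)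
  show "poly ?p f = 0" by (simp add: poly_monom)
qed

lemma power_in_place_units:
  assumes "val_ring Q" "0 < n" "f ^ n \<in> place_units Q"
  shows "f \<in> place_units Q"
  using assms power_in_val_ring[of Q n f] power_in_val_ring[of Q n "inverse f"]
  by (auto simp: place_units_def power_inverse)

text \<open>One element \<open>t\<close> serves all members of \<open>I\<close> at once, so pole
  orders can be compared before it is known that there is only one place at infinity.\<close>

locale common_uniformizer =
  fixes I :: "'a::field set set" and t :: 'a
  assumes val_rings: "\<And>Q. Q \<in> I \<Longrightarrow> val_ring Q"
    and t_in: "\<And>Q. Q \<in> I \<Longrightarrow> t \<in> Q" and t_nonunit: "\<And>Q. Q \<in> I \<Longrightarrow> inverse t \<notin> Q"
    and t_nonzero: "t \<noteq> 0" and nonempty: "I \<noteq> {}"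
begin

text \<open>A relation rather than a function: that every nonzero \<open>f\<close> has the same
  order at all members of \<open>I\<close> has to be proved in each case.\<close>

definition pole_order :: "'a \<Rightarrow> int \<Rightarrow> bool" where
  "pole_order f e \<longleftrightarrow> (\<forall>Q\<in>I. f * t powi e \<in> place_units Q)"

lemma t_powi_in: "Q \<in> I \<Longrightarrow> 0 \<le> e \<Longrightarrow> t powi e \<in> Q"
  using t_in subring_power[OF val_ring_subring[OF val_rings]] by (auto simp: power_int_def)

lemma t_powi_notin:
  assumes Q: "Q \<in> I" and "e < 0"
  shows "t powi e \<notin> Q"
proof
  assume "t powi e \<in> Q"
  moreover have "t powi (- e - 1) \<in> Q" using assms by (intro t_powi_in) auto
  ultimately have "t powi e * t powi (- e - 1) \<in> Q"
    using subring_mult[OF val_ring_subring[OF val_rings[OF Q]]] by blast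
  moreover have "t powi e * t powi (- e - 1) = inverse t"
    using t_nonzero by (simp add: power_int_minus flip: power_int_add)
  ultimately show False using t_nonunit[OF Q] by simp
qed

lemma unit_times_powi_in_iff:
  assumes Q: "Q \<in> I" and u: "u \<in> place_units Q"
  shows "u * t powi e \<in> Q \<longleftrightarrow> 0 \<le> e"
proof
  assume a: "u * t powi e \<in> Q"
  have "inverse u * (u * t powi e) \<in> Q"
    using u a subring_mult[OF val_ring_subring[OF val_rings[OF Q]]] by (auto simp: place_units_def)
  moreover have "inverse u * (u * t powi e) = t powi e" using u by (auto simp: place_units_def)
  ultimately show "0 \<le> e" using t_powi_notin[OF Q, of e] by (metis not_less)
next
  assume "0 \<le> e"
  then show "u * t powi e \<in> Q"
    using u t_powi_in[OF Q] subring_mult[OF val_ring_subring[OF val_rings[OF Q]]]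
    by (auto simp: place_units_def)
qed

lemma pole_order_eq:
  assumes "pole_order f e" and Q: "Q \<in> I"
  obtains u where "u \<in> place_units Q" "f = u * t powi (- e)"
proof (rule that)
  show "f * t powi e \<in> place_units Q" using assms by (auto simp: pole_order_def)
  show "f = f * t powi e * t powi (- e)"
    using t_nonzero by (simp add: mult.assoc flip: power_int_add)
qed

lemma pole_order_in_iff: "pole_order f e \<Longrightarrow> Q \<in> I \<Longrightarrow> f \<in> Q \<longleftrightarrow> e \<le> 0"
  using unit_times_powi_in_iff by (metis pole_order_eq neg_0_le_iff_le)

lemma pole_order_nonzero: "pole_order f e \<Longrightarrow> f \<noteq> 0"
  using nonempty by (auto simp: pole_order_def place_units_def)

lemma pole_order_mult: "pole_order f e \<Longrightarrow> pole_order g e' \<Longrightarrow> pole_order (f * g) (e + e')"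
  unfolding pole_order_def
  using place_units_mult[OF val_rings] t_nonzero
  by (force simp: power_int_add mult_ac)

lemma pole_order_inverse: "pole_order f e \<Longrightarrow> pole_order (inverse f) (- e)"
  unfolding pole_order_def
  using place_units_inverse by (force simp: power_int_minus)

lemma pole_order_1: "pole_order 1 0"
  using val_rings[THEN val_ring_subring, THEN subring_1] by (simp add: pole_order_def place_units_def)

lemma pole_order_power: "pole_order f e \<Longrightarrow> pole_order (f ^ n) (int n * e)"
proof (induction n)
  case (Suc n)
  then show ?case using pole_order_mult[of f e "f ^ n" "int n * e"] by (simp add: algebra_simps)
qed (simp add: pole_order_1)

lemma pole_order_unique:
  assumes "pole_order f e" "pole_order f e'"
  shows "e = e'"
proof -
  have *: "pole_order (f * inverse f) (e - e')" "pole_order (f * inverse f) (e' - e)"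
    using assms pole_order_mult pole_order_inverse by (metis diff_conv_add_uminus)+
  obtain Q where Q: "Q \<in> I" using nonempty by blast
  have "f * inverse f \<in> Q"
    using pole_order_nonzero[OF assms(1)] subring_1[OF val_ring_subring[OF val_rings[OF Q]]] by simp
  then show ?thesis using *[THEN pole_order_in_iff, OF Q] by simp
qed

text \<open>Valuation rings are integrally closed, so an element with a power that is a unit is
  itself a unit.\<close>

lemma pole_order_root:
  assumes "0 < n" "pole_order (f ^ n) (int n * e)"
  shows "pole_order f e"
proof -
  have "(f * t powi e) ^ n = f ^ n * t powi (int n * e)"
    by (simp add: power_mult_distrib mult.commute[of "int n"] power_int_mult)
  then show ?thesis
    using assms power_in_place_units[OF val_rings, of _ n "f * t powi e"] by (auto simp: pole_order_def)
qed

text \<open>The strict ultrametric law. Zero is listed separately because it has no pole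
  order.\<close>

lemma pole_order_add:
  assumes f: "pole_order f e" and g: "g = 0 \<or> (\<exists>e'<e. pole_order g e')"
  shows "pole_order (f + g) e"
proof (cases "g = 0")
  case False
  then obtain e' where e': "e' < e" "pole_order g e'" using g by blast
  show ?thesis
    unfolding pole_order_def
  proof
    fix Q assume Q: "Q \<in> I"
    note V = val_rings[OF Q]
    note S = val_ring_subring[OF V]
    define u m w where "u = f * t powi e" and "m = g * t powi e" and "w = u + m"
    have u: "u \<in> Q" "inverse u \<in> Q" "u \<noteq> 0" using f Q by (auto simp: pole_order_def u_def place_units_def)
    define v where "v = g * t powi e'"
    have v: "v \<in> place_units Q" using e' Q by (auto simp: v_def pole_order_def)
    have mv: "m = v * t powi (e - e')"
      using t_nonzero by (simp add: m_def v_def mult.assoc flip: power_int_add)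
    have m: "m \<in> Q" using unit_times_powi_in_iff[OF Q v] e' mv by simp
    have "inverse m = inverse v * t powi (e' - e)"
      using mv by (simp flip: power_int_minus)
    then have m': "inverse m \<notin> Q" using unit_times_powi_in_iff[OF Q place_units_inverse[OF v], of "e' - e"] e' by simp
    have m0: "m \<noteq> 0" using False t_nonzero by (simp add: m_def)
    have wQ: "w \<in> Q" using u m S by (simp add: w_def subring_add)
    have w0: "w \<noteq> 0"
    proof
      assume "w = 0"
      then have "m = - u" by (simp add: w_def eq_neg_iff_add_eq_0 add.commute)
      then have "inverse m \<in> Q" using u S by (simp add: subring_uminus)
      then show False using m' by simp
    qed
    \<comment> \<open>Of \<open>m / w\<close> and \<open>w / m\<close> one lies in \<open>Q\<close>:
      the first yields \<open>inverse w\<close>, the second would put \<open>inverse m\<close> into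
      \<open>Q\<close>.\<close>
    have "inverse w \<in> Q"
    proof (cases "m / w \<in> Q")
      case True
      have "inverse w = inverse u * (1 - m / w)"
        using w0 u(3) by (simp add: field_simps) (simp add: w_def)
      then show ?thesis
        using subring_mult[OF S u(2) subring_diff[OF S subring_1[OF S] True]] by simp
    next
      case F: False
      have wm: "w / m \<in> Q" using V F m0 w0 unfolding val_ring_def
        by (metis divide_eq_0_iff inverse_divide)
      moreover have "inverse m = inverse u * (w / m - 1)"
        using m0 u(3) by (simp add: field_simps) (simp add: w_def)
      ultimately have "inverse m \<in> Q"
        using subring_mult[OF S u(2) subring_diff[OF S wm subring_1[OF S]]] by simp
      then show ?thesis using m' by simp
    qed
    moreover have "(f + g) * t powi e = w" by (simp add: w_def u_def m_def algebra_simps)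
    ultimately show "(f + g) * t powi e \<in> place_units Q"
      using wQ w0 by (simp add: place_units_def)
  qed
qed (use f in simp)

text \<open>As \<open>D\<close> and its translate by \<open>e\<close> are disjoint, the terms
  \<open>a\<close> and \<open>b * w\<close> never have equal pole order and cannot cancel. This is
  one step of the tower.\<close>

lemma pole_order_span2:
  assumes A: "\<And>f. f \<in> A \<Longrightarrow> f \<noteq> 0 \<Longrightarrow> \<exists>d\<in>D. pole_order f d" and w: "pole_order w e"
    and D: "\<And>d d'. d \<in> D \<Longrightarrow> d' \<in> D \<Longrightarrow> d \<noteq> d' + e"
    and f: "f \<in> span2 w A" "f \<noteq> 0"
  shows "\<exists>d \<in> D \<union> (\<lambda>d. d + e) ` D. pole_order f d"
proof -
  obtain a b where ab: "a \<in> A" "b \<in> A" "f = a + b * w" using f by (auto simp: span2_def)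
  show ?thesis
  proof (cases "a = 0 \<or> b = 0")
    case True
    show ?thesis
    proof (cases "b = 0")
      case True
      then show ?thesis using A[OF ab(1)] ab(3) f(2) by auto
    next
      case False
      then have "f = b * w" using \<open>a = 0 \<or> b = 0\<close> ab(3) by simp
      moreover obtain d where "d \<in> D" "pole_order b d" using A[OF ab(2) False] by blast
      ultimately show ?thesis using pole_order_mult[OF _ w, of b d] by blast
    qed
  next
    case False
    then obtain d d' where d: "d \<in> D" "pole_order a d" "d' \<in> D" "pole_order b d'" using A ab by blast
    have *: "pole_order (b * w) (d' + e)" using pole_order_mult d w by blast
    consider "d < d' + e" | "d' + e < d" using D d by (metis linorder_neqE)
    then show ?thesis
    proof cases
      case 1
      then have "pole_order f (d' + e)"
        using pole_order_add[OF *, of a] d(2) unfolding ab(3) by (metis add.commute)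
      then show ?thesis using d(3) by blast
    next
      case 2
      then have "pole_order f d"
        using pole_order_add[OF d(2), of "b * w"] * unfolding ab(3) by metis
      then show ?thesis using d(1) by blast
    qed
  qed
qed

lemma notin_of_pole_order:
  assumes "\<And>f. f \<in> A \<Longrightarrow> f \<noteq> 0 \<Longrightarrow> \<exists>d\<in>D. pole_order f d" "pole_order w e" "e \<notin> D"
  shows "w \<notin> A"
  using assms pole_order_unique pole_order_nonzero by blast

end

section \<open>The function field of the curve\<close>

text \<open>Translation by 1 permutes \<open>K\<close>; comparing the sums of all elements shows
  that \<open>card K\<close>, a power of 2, vanishes in the field.\<close>

lemma char_2_of_card_subfield:
  assumes K: "subfield (K::'a::field set) fld" and fin: "finite K" and card: "card K = 2 ^ n"
  shows "(2::'a) = 0"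
proof -
  have R: "subring K fld" using K by (simp add: subfield_fld_iff)
  have "bij_betw (\<lambda>a. a + 1) K K"
    by (rule bij_betw_byWitness[of _ "\<lambda>a. a - 1"])
       (auto simp: subring_add[OF R] subring_diff[OF R] subring_1[OF R])
  then have "(\<Sum>a\<in>K. a + 1) = \<Sum>K" by (rule sum.reindex_bij_betw)
  then have "of_nat (card K) = (0::'a)" by (simp add: sum.distrib)
  then have "(2::'a) ^ n = 0" by (simp add: card)
  then show ?thesis by simp
qed

lemma places_iff: "Q \<in> places K \<longleftrightarrow> val_ring Q \<and> K \<subset> Q \<and> Q \<noteq> UNIV"
  by (auto simp: places_def val_ring_def)

definition GGS_semigroup :: "nat \<Rightarrow> nat set" where
  "GGS_semigroup m = {3 * i * m + 2 * j * m + 8 * k | i j k. i \<le> 1 \<and> j \<le> 3}"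

locale GGS_curve =
  fixes m q :: nat and K P :: "'a::field set" and x y z :: 'a
  assumes K: "subfield K fld" and char2: "(2::'a) = 0" and m: "m = 8 * q + 3"
    and xy: "x ^ 2 + x = y ^ 3" and yz: "y ^ 4 - y = z ^ m"
    and gen: "generate_field fld (K \<union> {x, y, z}) = UNIV"
    and P: "place_at_infinity K x y z P"
begin

section \<open>The coordinates at finite places and at infinity\<close>

lemma subring_K: "subring K fld"
  using K by (simp add: subfield_fld_iff)

text \<open>The curve equations are monic in \<open>y\<close> over \<open>z\<close>, and in
  \<open>x\<close> over \<open>y\<close>.\<close>

lemma coordinates_in_val_ring:
  assumes Q: "val_ring Q" and "z \<in> Q"
  shows "y \<in> Q" "x \<in> Q"
proof -
  note S = val_ring_subring[OF Q]
  note [simp] = polys_over_pCons[OF S] polys_over_0[OF S] subring_0[OF S] subring_1[OF S]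
  have 1: "[:- (z ^ m), - 1, 0, 0, 1:] \<in> polys_over Q"
    using assms(2) by (simp add: subring_uminus[OF S] subring_power[OF S])
  show y: "y \<in> Q"
  proof (rule monic_root_in_val_ring[OF Q 1])
    show "poly [:- (z ^ m), - 1, 0, 0, 1:] y = 0"
      using yz by (simp add: algebra_simps eval_nat_numeral)
  qed simp
  have 2: "[:- (y ^ 3), 1, 1:] \<in> polys_over Q"
    using y by (simp add: subring_uminus[OF S] subring_power[OF S])
  show "x \<in> Q"
  proof (rule monic_root_in_val_ring[OF Q 2])
    show "poly [:- (y ^ 3), 1, 1:] x = 0"
      using xy by (simp add: algebra_simps eval_nat_numeral)
  qed simp
qed

text \<open>All candidates for a place at infinity; \<open>infty_eq\<close> shows later that
  \<open>P\<close> is the only one.\<close>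

definition infty :: "'a set set" where
  "infty = {Q. val_ring Q \<and> K \<subseteq> Q \<and> z \<notin> Q}"

text \<open>Up to units, \<open>x\<^sup>2 = y\<^sup>3\<close> and \<open>y\<^sup>4 = z\<^sup>m\<close> at infinity, so the pole orders of \<open>x, y, z\<close> are
  \<open>3m, 2m, 8\<close>, and the exponents of \<open>t\<close> solve \<open>3 * (2m - 3m) + (3q + 1) * 8 = - 1\<close>.\<close>

definition t :: 'a where
  "t = (y / x) ^ 3 * z ^ (3 * q + 1)"

text \<open>The inverse of \<open>1 + inverse h\<close> is \<open>1 - inverse (h + 1)\<close>, and
  \<open>h + 1\<close> lies outside \<open>Q\<close> together with \<open>h\<close>.\<close>

lemma one_plus_inverse_unit:
  assumes Q: "val_ring Q" and h: "h \<notin> Q"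
  shows "1 + inverse h \<in> place_units Q"
proof -
  note S = val_ring_subring[OF Q]
  have h0: "h \<noteq> 0" using h subring_0[OF S] by auto
  have h1: "h + 1 \<notin> Q" using h subring_diff[OF S _ subring_1[OF S], of "h + 1"] by auto
  then have n: "h + 1 \<noteq> 0" using subring_0[OF S] by auto
  have i: "inverse h \<in> Q" "inverse (h + 1) \<in> Q" using Q h h1 h0 n by (auto simp: val_ring_def)
  have e: "1 + inverse h = (h + 1) / h" using h0 by (simp add: field_simps)
  have "inverse (1 + inverse h) = 1 - inverse (h + 1)"
    unfolding e using h0 n by (simp add: field_simps)
  then show ?thesis
    unfolding place_units_def
    using i e h0 n subring_add[OF S subring_1[OF S] i(1)] subring_diff[OF S subring_1[OF S] i(2)] by auto
qed

context
  fixes Q assumes Q: "Q \<in> infty"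
begin

lemma val_ring_infty: "val_ring Q"
  using Q by (simp add: infty_def)

lemma coordinates_notin: "z \<notin> Q" "y \<notin> Q" "x \<notin> Q"
proof -
  note V = val_ring_infty
  note S = val_ring_subring[OF V]
  show z: "z \<notin> Q" using Q by (simp add: infty_def)
  show y: "y \<notin> Q"
  proof
    assume "y \<in> Q"
    then have "z ^ m \<in> Q" using yz[symmetric] by (simp add: subring_diff[OF S] subring_power[OF S])
    then show False using power_in_val_ring[OF V, of m z] z m by simp
  qed
  show "x \<notin> Q"
  proof
    assume "x \<in> Q"
    then have "y ^ 3 \<in> Q" using xy[symmetric] by (simp add: subring_add[OF S] subring_power[OF S])
    then show False using power_in_val_ring[OF V, of 3 y] y by simp
  qed
qed

lemma coordinates_nonzero: "x \<noteq> 0" "y \<noteq> 0" "z \<noteq> 0"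
  using coordinates_notin subring_0[OF val_ring_subring[OF val_ring_infty]] by auto

lemma y3_over_x2_unit: "y ^ 3 / x ^ 2 \<in> place_units Q"
proof -
  have "y ^ 3 / x ^ 2 = 1 + inverse x"
    using coordinates_nonzero unfolding xy[symmetric] by (simp add: field_simps power2_eq_square)
  then show ?thesis using one_plus_inverse_unit[OF val_ring_infty coordinates_notin(3)] by simp
qed

lemma zm_over_y4_unit: "z ^ m / y ^ 4 \<in> place_units Q"
proof -
  note S = val_ring_subring[OF val_ring_infty]
  have n: "- (y ^ 3) \<notin> Q"
    using power_in_val_ring[OF val_ring_infty, of 3 y] coordinates_notin(2) subring_uminus[OF S, of "- (y ^ 3)"]
    by auto
  have "z ^ m / y ^ 4 = 1 + inverse (- (y ^ 3))"
    using coordinates_nonzero unfolding yz[symmetric] by (simp add: field_simps eval_nat_numeral)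
  then show ?thesis using one_plus_inverse_unit[OF val_ring_infty n] by simp
qed

lemma z_t_unit: "z * t ^ 8 \<in> place_units Q"
proof -
  note U = place_units_mult[OF val_ring_infty]
  have pow: "u ^ n \<in> place_units Q" if "u \<in> place_units Q" for u n
    using that subring_power[OF val_ring_subring[OF val_ring_infty]]
    by (auto simp: place_units_def simp flip: power_inverse)
  have "z * t ^ 8 = y ^ 24 * z ^ (3 * m) / x ^ 24"
    by (simp add: t_def m power_mult_distrib power_divide power_add field_simps flip: power_mult)
      (simp add: eval_nat_numeral)
  \<comment> \<open>The power of \<open>x\<close> forces the exponent 12 and that of
    \<open>z\<close> the exponent 3; the powers of \<open>y\<close> then agree, as 36 - 12 =
    24.\<close>
  also have "\<dots> = (y ^ 3 / x ^ 2) ^ 12 * (z ^ m / y ^ 4) ^ 3"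
    using coordinates_nonzero
    by (simp add: power_mult_distrib power_divide field_simps flip: power_mult power_add)
  finally show ?thesis using U pow y3_over_x2_unit zm_over_y4_unit by simp
qed

lemma t_nonzero': "t \<noteq> 0"
  using coordinates_nonzero by (simp add: t_def)

lemma t_in_infty: "t \<in> Q"
proof -
  note S = val_ring_subring[OF val_ring_infty]
  have "inverse z \<in> Q"
    using coordinates_notin(1) coordinates_nonzero(3) val_ring_infty by (auto simp: val_ring_def)
  then have "z * t ^ 8 * inverse z \<in> Q" using z_t_unit subring_mult[OF S] by (auto simp: place_units_def)
  moreover have "z * t ^ 8 * inverse z = t ^ 8" using coordinates_nonzero by simp
  ultimately have "t ^ 8 \<in> Q" by simp
  then show ?thesis using power_in_val_ring[OF val_ring_infty, of 8] by simp
qed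

lemma inverse_t_notin_infty: "inverse t \<notin> Q"
proof
  note S = val_ring_subring[OF val_ring_infty]
  assume "inverse t \<in> Q"
  then have "z * t ^ 8 * inverse t ^ 8 \<in> Q"
    using z_t_unit subring_mult[OF S] subring_power[OF S] by (auto simp: place_units_def)
  moreover have "z * t ^ 8 * inverse t ^ 8 = z" using t_nonzero' by (simp add: field_simps)
  ultimately have "z \<in> Q" by simp
  then show False using coordinates_notin by simp
qed

end

lemma P_in_infty: "P \<in> infty"
  using P coordinates_in_val_ring[of P] unfolding place_at_infinity_def places_iff infty_def by auto

sublocale common_uniformizer infty t
  using val_ring_infty t_in_infty inverse_t_notin_infty t_nonzero' P_in_infty
  by unfold_locales auto

lemma pole_order_z: "pole_order z 8"
  using z_t_unit by (simp add: pole_order_def)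

text \<open>Up to a unit \<open>y ^ 4\<close> equals \<open>z ^ m\<close>, of pole order
  \<open>8 * m\<close>; then a fourth root is taken.\<close>

lemma pole_order_y: "pole_order y (2 * int m)"
proof (rule pole_order_root)
  have "pole_order (inverse (z ^ m / y ^ 4) * z ^ m) (- 0 + int m * 8)"
    using zm_over_y4_unit pole_order_z
    by (intro pole_order_mult pole_order_inverse pole_order_power) (auto simp: pole_order_def)
  then show "pole_order (y ^ 4) (int 4 * (2 * int m))"
    using coordinates_nonzero[OF P_in_infty] by (simp add: mult.commute)
qed simp

lemma pole_order_x: "pole_order x (3 * int m)"
proof (rule pole_order_root)
  have "pole_order (inverse (y ^ 3 / x ^ 2) * y ^ 3) (- 0 + int 3 * (2 * int m))"
    using y3_over_x2_unit pole_order_y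
    by (intro pole_order_mult pole_order_inverse pole_order_power) (auto simp: pole_order_def)
  then show "pole_order (x ^ 2) (int 2 * (3 * int m))"
    using coordinates_nonzero[OF P_in_infty] by (simp add: mult.commute)
qed simp

lemma pole_order_const: "c \<in> K \<Longrightarrow> c \<noteq> 0 \<Longrightarrow> pole_order c 0"
  unfolding pole_order_def place_units_def using K by (auto simp: infty_def subfield_fld_iff)

text \<open>As \<open>e\<close> is positive, the constant term never matters in a Horner step. In
  particular \<open>h\<close> is transcendental over \<open>K\<close>.\<close>

lemma pole_order_poly:
  assumes h: "pole_order h e" "0 < e" and p: "p \<in> polys_over K" "p \<noteq> 0"
  shows "pole_order (poly p h) (int (Polynomial.degree p) * e)"
  using p
proof (induction p)
  case (pCons c p)
  then have c: "c \<in> K" and p: "p \<in> polys_over K" by (simp_all add: polys_over_pCons[OF subring_K])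
  show ?case
  proof (cases "p = 0")
    case True
    then show ?thesis using pCons.hyps pole_order_const[OF c] by simp
  next
    case False
    have "pole_order (h * poly p h) (e + int (Polynomial.degree p) * e)"
      using pCons.IH p False h by (intro pole_order_mult) auto
    moreover have "0 < e + int (Polynomial.degree p) * e" using h(2) by (simp add: add_pos_nonneg)
    ultimately have "pole_order (h * poly p h + c) (e + int (Polynomial.degree p) * e)"
      using pole_order_const[OF c] by (intro pole_order_add) auto
    then show ?thesis using False by (simp add: algebra_simps)
  qed
qed simp

section \<open>The rational function field K(z) and its integral elements\<close>

definition rational :: "'a set" where
  "rational = {poly p z / poly r z | p r. p \<in> polys_over K \<and> r \<in> polys_over K \<and> r \<noteq> 0}"

lemma poly_z_nonzero: "p \<in> polys_over K \<Longrightarrow> p \<noteq> 0 \<Longrightarrow> poly p z \<noteq> 0"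
  using pole_order_poly[OF pole_order_z] pole_order_nonzero by fastforce

lemma adjoin_subset_rational: "adjoin K z \<subseteq> rational"
proof
  fix f assume "f \<in> adjoin K z"
  then obtain p where "p \<in> polys_over K" "f = poly p z / poly 1 z" by (auto simp: adjoin_def)
  moreover have "1 \<in> polys_over K"
    by (simp add: one_pCons polys_over_pCons[OF subring_K] polys_over_0[OF subring_K] subring_1[OF subring_K])
  ultimately show "f \<in> rational" unfolding rational_def using one_neq_zero by blast
qed

lemma subfield_rational: "subfield rational fld"
  unfolding subfield_fld_iff subring_fld_iff
proof (intro conjI ballI)
  show "1 \<in> rational"
    using adjoin_subset_rational subring_1[OF subring_adjoin[OF subring_K]] by blast
  fix f assume "f \<in> rational"
  then obtain p1 q1 where 1: "p1 \<in> polys_over K" "q1 \<in> polys_over K" "q1 \<noteq> 0" "f = poly p1 z / poly q1 z"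
    by (auto simp: rational_def)
  show "inverse f \<in> rational"
  proof (cases "p1 = 0")
    case True
    then show ?thesis using 1(4) \<open>f \<in> rational\<close> by simp
  next
    case False
    then show ?thesis using 1 unfolding rational_def by (auto simp: inverse_divide)
  qed
  fix g assume "g \<in> rational"
  then obtain p2 q2 where 2: "p2 \<in> polys_over K" "q2 \<in> polys_over K" "q2 \<noteq> 0" "g = poly p2 z / poly q2 z"
    by (auto simp: rational_def)
  note nz = poly_z_nonzero[OF 1(2,3)] poly_z_nonzero[OF 2(2,3)]
  have q: "q1 * q2 \<in> polys_over K" "q1 * q2 \<noteq> 0" using 1 2 polys_over_mult[OF subring_K] by auto
  have "f - g = poly (p1 * q2 - p2 * q1) z / poly (q1 * q2) z"
    using nz by (simp add: 1 2 field_simps)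
  moreover have "p1 * q2 - p2 * q1 \<in> polys_over K"
    using 1 2 subring_K by (intro polys_over_diff polys_over_mult)
  ultimately show "f - g \<in> rational" unfolding rational_def using q by blast
  have "f * g = poly (p1 * p2) z / poly (q1 * q2) z" by (simp add: 1 2)
  moreover have "p1 * p2 \<in> polys_over K" using 1 2 subring_K by (intro polys_over_mult)
  ultimately show "f * g \<in> rational" unfolding rational_def using q by blast
qed

lemma pole_order_rational:
  assumes "p \<in> polys_over K" "r \<in> polys_over K" "p \<noteq> 0" "r \<noteq> 0"
  shows "pole_order (poly p z / poly r z) (8 * (int (Polynomial.degree p) - int (Polynomial.degree r)))"
  using pole_order_mult[OF pole_order_poly[OF pole_order_z _ assms(1,3)]
      pole_order_inverse[OF pole_order_poly[OF pole_order_z _ assms(2,4)]]]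
  by (simp add: divide_inverse algebra_simps)

lemma adjoin_subset_iff:
  assumes "val_ring Q"
  shows "adjoin K z \<subseteq> Q \<longleftrightarrow> K \<subseteq> Q \<and> z \<in> Q"
proof
  assume "adjoin K z \<subseteq> Q"
  then show "K \<subseteq> Q \<and> z \<in> Q" using subset_adjoin[OF subring_K] adjoin_self[OF subring_K] by blast
next
  assume *: "K \<subseteq> Q \<and> z \<in> Q"
  then have "poly p z \<in> Q" if "p \<in> polys_over K" for p
    using poly_in_subring[OF val_ring_subring[OF assms]] that polys_over_mono by blast
  then show "adjoin K z \<subseteq> Q" by (auto simp: adjoin_def)
qed

text \<open>A function without any pole is algebraic over \<open>K\<close>, hence it has no zero either.\<close>

lemma integral_zero_at_infinity:
  assumes "c \<in> integral_closure (adjoin K z)" "pole_order c e"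
  shows "0 \<le> e"
proof (rule ccontr)
  assume e: "\<not> 0 \<le> e"
  have "c \<in> integral_closure K"
    unfolding integral_closure_def
  proof (intro CollectI allI impI)
    fix Q assume Q: "val_ring Q" "K \<subseteq> Q"
    show "c \<in> Q"
    proof (cases "z \<in> Q")
      case True
      then show ?thesis using assms(1) adjoin_subset_iff[OF Q(1)] Q by (auto simp: integral_closure_def)
    next
      case False
      then show ?thesis using pole_order_in_iff[OF assms(2)] Q e by (auto simp: infty_def)
    qed
  qed
  then obtain p where p: "p \<in> polys_over K" "Polynomial.lead_coeff p = 1" "poly p c = 0"
    using integral_closure_iff[OF subring_K] by blast
  have c0: "c \<noteq> 0" using pole_order_nonzero assms(2) by blast
  \<comment> \<open>\<open>inverse c\<close> has a positive pole order, hence satisfies no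
    polynomial equation over \<open>K\<close>.\<close>
  have "reflect_poly p \<noteq> 0" using p(2) by auto
  then have "pole_order (poly (reflect_poly p) (inverse c))
      (int (Polynomial.degree (reflect_poly p)) * - e)"
    using p(1) e assms(2) subring_K
    by (intro pole_order_poly pole_order_inverse polys_over_reflect) auto
  then have "poly (reflect_poly p) (inverse c) \<noteq> 0" by (rule pole_order_nonzero)
  then show False using p(3) c0 by (simp add: poly_reflect_poly_nz)
qed

text \<open>Division with remainder: a nonzero integral fraction cannot vanish at infinity, so its
  numerator has at least the degree of \<open>r\<close>. Subtracting the leading monomial quotient
  keeps the fraction integral and lowers that degree.\<close>

lemma integral_rational: "integral_closure (adjoin K z) \<inter> rational \<subseteq> adjoin K z"
proof
  note S = subring_K
  have "poly p z / poly r z \<in> adjoin K z"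
    if "p \<in> polys_over K" and r: "r \<in> polys_over K" "r \<noteq> 0"
      and "poly p z / poly r z \<in> integral_closure (adjoin K z)" for p r
    using that(1,4)
  proof (induction "Polynomial.degree p" arbitrary: p rule: less_induct)
    case less
    show ?case
    proof (cases "p = 0")
      case True
      then show ?thesis using subring_0[OF subring_adjoin[OF S]] by simp
    next
      case False
      have "Polynomial.degree r \<le> Polynomial.degree p"
        using integral_zero_at_infinity[OF less.prems(2) pole_order_rational[OF less.prems(1) r(1) False r(2)]]
        by simp
      define n c where "n = Polynomial.degree p - Polynomial.degree r"
        and "c = Polynomial.lead_coeff p / Polynomial.lead_coeff r"
      have c: "c \<in> K"
        using less.prems(1) r(1) K subring_mult[OF S]
        by (auto simp: c_def divide_inverse polys_over_def subfield_fld_iff)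
      define p' where "p' = p - Polynomial.monom c n * r"
      have p': "p' \<in> polys_over K"
        unfolding p'_def using less.prems(1) r c S
        by (intro polys_over_diff polys_over_mult polys_over_monom)
      have h: "poly (Polynomial.monom c n) z \<in> adjoin K z"
        using polys_over_monom[OF S c] by (auto simp: adjoin_def)
      have e: "poly p' z / poly r z = poly p z / poly r z - poly (Polynomial.monom c n) z"
        using poly_z_nonzero[OF r] by (simp add: p'_def field_simps)
      have "poly p' z / poly r z \<in> adjoin K z"
      proof -
        have "Polynomial.degree (Polynomial.monom c n * r) \<le> Polynomial.degree p"
          using degree_mult_le[of "Polynomial.monom c n" r] degree_monom_le[of c n]
            \<open>Polynomial.degree r \<le> _\<close> by (simp add: n_def)
        then have "Polynomial.degree p' \<le> Polynomial.degree p"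
          unfolding p'_def by (intro Polynomial.degree_diff_le) auto
        moreover have "poly.coeff p' (Polynomial.degree p) = 0"
        proof -
          have "poly.coeff (Polynomial.monom c n * r) (n + Polynomial.degree r) = c * Polynomial.lead_coeff r"
            by (simp add: Polynomial.coeff_monom_mult)
          then show ?thesis using r(2) \<open>Polynomial.degree r \<le> _\<close> by (simp add: p'_def n_def c_def)
        qed
        ultimately have "p' = 0 \<or> Polynomial.degree p' < Polynomial.degree p"
          by (rule eq_zero_or_degree_less)
        moreover have "poly p' z / poly r z \<in> integral_closure (adjoin K z)"
          unfolding e using less.prems(2) h subset_integral_closure
          by (intro subring_diff[OF subring_integral_closure]) auto
        ultimately show ?thesis using less.hyps[OF _ p'] subring_0[OF subring_adjoin[OF S]] by auto
      qed
      then have "poly p' z / poly r z + poly (Polynomial.monom c n) z \<in> adjoin K z"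
        using h subring_add[OF subring_adjoin[OF S]] by blast
      then show ?thesis unfolding e by simp
    qed
  qed
  then show "f \<in> adjoin K z" if "f \<in> integral_closure (adjoin K z) \<inter> rational" for f
    using that by (auto simp: rational_def)
qed

section \<open>The tower of three Artin-Schreier extensions\<close>

definition s :: 'a where
  "s = y\<^sup>2 + y"

lemma s_eq: "s\<^sup>2 + s = z ^ m"
proof -
  have "s\<^sup>2 + s = (y ^ 4 - y) + 2 * (y ^ 3 + y\<^sup>2 + y)"
    by (simp add: s_def eval_nat_numeral algebra_simps)
  then show ?thesis using char2 yz by simp
qed

lemma pole_order_s: "pole_order s (4 * int m)"
  unfolding s_def using m pole_order_power[OF pole_order_y, of 2] pole_order_y
  by (intro pole_order_add) (auto intro!: exI[of _ "2 * int m"])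

lemma int_m: "int m = 8 * int q + 3"
  by (simp add: m)

abbreviation "E1 \<equiv> span2 s rational"
abbreviation "E2 \<equiv> span2 y E1"
abbreviation "E3 \<equiv> span2 x E2"

lemma pole_order_rational':
  assumes "f \<in> rational" "f \<noteq> 0"
  shows "\<exists>d\<in>{d. 8 dvd d}. pole_order f d"
proof -
  obtain p r where pr: "p \<in> polys_over K" "r \<in> polys_over K" "r \<noteq> 0" "f = poly p z / poly r z"
    using assms(1) by (auto simp: rational_def)
  then have "p \<noteq> 0" using assms(2) by auto
  then show ?thesis using pole_order_rational[OF pr(1,2) _ pr(3)] pr(4) by (metis dvd_triv_left mem_Collect_eq)
qed

text \<open>\<open>4 * m\<close> is 4 modulo 8, so multiples of 8 are shifted off themselves. In the
  same way \<open>2 * m\<close> moves multiples of 4 and the odd number \<open>3 * m\<close> moves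
  even numbers in the next two steps.\<close>

lemma pole_order_E1:
  assumes "f \<in> E1" "f \<noteq> 0"
  shows "\<exists>d\<in>{d. 4 dvd d}. pole_order f d"
proof -
  have "\<exists>d\<in>{d. 8 dvd d} \<union> (\<lambda>d. d + 4 * int m) ` {d. 8 dvd d}. pole_order f d"
  proof (rule pole_order_span2[OF pole_order_rational' pole_order_s _ assms])
    fix d d' :: int assume "d \<in> {d. 8 dvd d}" "d' \<in> {d. 8 dvd d}"
    then show "d \<noteq> d' + 4 * int m" unfolding mem_Collect_eq using int_m by presburger
  qed
  moreover have "{d. 8 dvd d} \<union> (\<lambda>d. d + 4 * int m) ` {d. 8 dvd d} \<subseteq> {d. 4 dvd d}"
    using int_m by (auto; presburger)
  ultimately show ?thesis by blast
qed

lemma pole_order_E2: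
  assumes "f \<in> E2" "f \<noteq> 0"
  shows "\<exists>d\<in>{d. 2 dvd d}. pole_order f d"
proof -
  have "\<exists>d\<in>{d. 4 dvd d} \<union> (\<lambda>d. d + 2 * int m) ` {d. 4 dvd d}. pole_order f d"
  proof (rule pole_order_span2[OF pole_order_E1 pole_order_y _ assms])
    fix d d' :: int assume "d \<in> {d. 4 dvd d}" "d' \<in> {d. 4 dvd d}"
    then show "d \<noteq> d' + 2 * int m" unfolding mem_Collect_eq using int_m by presburger
  qed
  moreover have "{d. 4 dvd d} \<union> (\<lambda>d. d + 2 * int m) ` {d. 4 dvd d} \<subseteq> {d. 2 dvd d}"
    using int_m by (auto; presburger)
  ultimately show ?thesis by blast
qed

lemma pole_order_E3:
  assumes "f \<in> E3" "f \<noteq> 0"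
  shows "\<exists>d. pole_order f d"
proof -
  have "\<exists>d\<in>{d. 2 dvd d} \<union> (\<lambda>d. d + 3 * int m) ` {d. 2 dvd d}. pole_order f d"
  proof (rule pole_order_span2[OF pole_order_E2 pole_order_x _ assms])
    fix d d' :: int assume "d \<in> {d. 2 dvd d}" "d' \<in> {d. 2 dvd d}"
    then show "d \<noteq> d' + 3 * int m" unfolding mem_Collect_eq using int_m by presburger
  qed
  then show ?thesis by blast
qed

lemma z_rational: "z \<in> rational"
  using adjoin_subset_rational adjoin_self[OF subring_K] by blast

text \<open>The pole order of the new generator does not occur in the field below, so the extension
  is proper; the same argument serves \<open>y\<close> and \<open>x\<close>.\<close>

lemma s_step: "s\<^sup>2 + s \<in> rational" "s \<notin> rational"
proof -
  show "s\<^sup>2 + s \<in> rational"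
    using subring_power[OF subfield_subring[OF subfield_rational] z_rational] by (simp add: s_eq)
  show "s \<notin> rational"
  proof (rule notin_of_pole_order[OF pole_order_rational' pole_order_s])
    show "4 * int m \<notin> {d. 8 dvd d}" unfolding mem_Collect_eq using int_m by presburger
  qed
qed

lemmas subfield_E1 = subfield_span2[OF subfield_rational s_step]

lemma y_step: "y\<^sup>2 + y \<in> E1" "y \<notin> E1"
proof -
  show "y\<^sup>2 + y \<in> E1"
    unfolding s_def[symmetric] by (rule self_in_span2[OF subfield_subring[OF subfield_rational]])
  show "y \<notin> E1"
  proof (rule notin_of_pole_order[OF pole_order_E1 pole_order_y])
    show "2 * int m \<notin> {d. 4 dvd d}" unfolding mem_Collect_eq using int_m by presburger
  qed
qed

lemmas subfield_E2 = subfield_span2[OF subfield_E1 y_step]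

lemma x_step: "x\<^sup>2 + x \<in> E2" "x \<notin> E2"
proof -
  show "x\<^sup>2 + x \<in> E2"
    unfolding xy using self_in_span2[OF subfield_subring[OF subfield_E1], of y] subfield_subring[OF subfield_E2]
    by (rule subring_power[rotated])
  show "x \<notin> E2"
  proof (rule notin_of_pole_order[OF pole_order_E2 pole_order_x])
    show "3 * int m \<notin> {d. 2 dvd d}" unfolding mem_Collect_eq using int_m by presburger
  qed
qed

lemmas subfield_E3 = subfield_span2[OF subfield_E2 x_step]

lemma E3_UNIV: "E3 = UNIV"
proof -
  interpret F: Ring.field "fld :: 'a ring" by (rule field_from_type_algebra)
  have 1: "rational \<subseteq> E1" "E1 \<subseteq> E2" "E2 \<subseteq> E3"
    by (intro subset_span2 subfield_subring subfield_rational subfield_E1 subfield_E2)+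
  have 2: "y \<in> E2" "x \<in> E3"
    by (intro self_in_span2 subfield_subring subfield_E1 subfield_E2)+
  have "K \<union> {x, y, z} \<subseteq> E3"
    using 1 2 z_rational subset_adjoin[OF subring_K, of z] adjoin_subset_rational by blast
  then have "generate_field fld (K \<union> {x, y, z}) \<subseteq> E3"
    using subfield_E3
    by (intro F.generate_field_min_subfield1) (auto simp: ring_of_type_algebra_def)
  then show ?thesis using gen by auto
qed

lemma pole_order_exists: "f \<noteq> 0 \<Longrightarrow> \<exists>d. pole_order f d"
  using pole_order_E3 E3_UNIV by blast

section \<open>The integral closure of K[z] and its pole orders\<close>

abbreviation "R \<equiv> adjoin K z"
abbreviation "R1 \<equiv> span2 s R"
abbreviation "R2 \<equiv> span2 y R1"
abbreviation "R3 \<equiv> span2 x R2"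

text \<open>Coordinates are descended level by level through \<open>integral_closure_span2\<close>
  until they lie in \<open>rational\<close>, where \<open>integral_rational\<close> makes them
  polynomials.\<close>

lemma integral_closure_subset: "integral_closure R \<subseteq> R3"
proof -
  let ?C = "integral_closure R"
  note A = subring_adjoin[OF subring_K]
  have 0: "R \<subseteq> rational" "rational \<subseteq> E1" "E1 \<subseteq> E2"
    by (intro adjoin_subset_rational subset_span2 subfield_subring subfield_rational subfield_E1)+
  have C: "y \<in> ?C" "x \<in> ?C"
    using coordinates_in_val_ring adjoin_subset_iff by (auto simp: integral_closure_def)
  have "s \<in> ?C"
    using C(1) unfolding s_def by (intro subring_add subring_power subring_integral_closure)
  note step = integral_closure_span2[OF _ _ _ char2 A]
  have 1: "?C \<inter> E1 \<subseteq> span2 s (?C \<inter> rational)"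
    using 0 \<open>s \<in> ?C\<close> by (intro step subfield_rational s_step) auto
  have 2: "?C \<inter> E2 \<subseteq> span2 y (?C \<inter> E1)"
    using 0 C by (intro step subfield_E1 y_step) auto
  have 3: "?C \<inter> E3 \<subseteq> span2 x (?C \<inter> E2)"
    using 0 C by (intro step subfield_E2 x_step) auto
  have "?C = ?C \<inter> E3" using E3_UNIV by simp
  also note 3
  also note span2_mono[OF 2]
  also note span2_mono[OF span2_mono[OF 1]]
  also note span2_mono[OF span2_mono[OF span2_mono[OF integral_rational]]]
  finally show ?thesis .
qed

lemma pole_order_R3:
  assumes "f \<in> R3" "f \<noteq> 0"
  shows "\<exists>r\<in>GGS_semigroup m. pole_order f (int r)"
proof -
  define D where "D = {8 * int k | k. True}"
  define D1 where "D1 = D \<union> (\<lambda>d. d + 4 * int m) ` D"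
  define D2 where "D2 = D1 \<union> (\<lambda>d. d + 2 * int m) ` D1"
  define D3 where "D3 = D2 \<union> (\<lambda>d. d + 3 * int m) ` D2"
  have D: "8 dvd d" if "d \<in> D" for d using that by (auto simp: D_def)
  have D1: "4 dvd d" if "d \<in> D1" for d using that by (auto simp: D1_def dest!: D)
  have D2: "2 dvd d" if "d \<in> D2" for d using that by (auto simp: D2_def dest!: D1)
  have 0: "\<exists>d\<in>D. pole_order g d" if nz: "g \<in> R" "g \<noteq> 0" for g
  proof -
    obtain p where p: "p \<in> polys_over K" "g = poly p z" using nz(1) by (auto simp: adjoin_def)
    then have "p \<noteq> 0" using nz(2) by auto
    then have "pole_order g (int (Polynomial.degree p) * 8)"
      using p pole_order_poly[OF pole_order_z _ p(1)] by simp
    then show ?thesis by (force simp: D_def mult.commute)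
  qed
  have 1: "\<exists>d\<in>D1. pole_order g d" if "g \<in> R1" "g \<noteq> 0" for g
    unfolding D1_def
  proof (rule pole_order_span2[OF 0 pole_order_s _ that])
    fix d d' assume "d \<in> D" "d' \<in> D"
    then show "d \<noteq> d' + 4 * int m" using int_m by (auto dest!: D; presburger)
  qed
  have 2: "\<exists>d\<in>D2. pole_order g d" if "g \<in> R2" "g \<noteq> 0" for g
    unfolding D2_def
  proof (rule pole_order_span2[OF 1 pole_order_y _ that])
    fix d d' assume "d \<in> D1" "d' \<in> D1"
    then show "d \<noteq> d' + 2 * int m" using int_m by (auto dest!: D1; presburger)
  qed
  have 3: "\<exists>d\<in>D3. pole_order f d"
    unfolding D3_def
  proof (rule pole_order_span2[OF 2 pole_order_x _ assms])
    fix d d' assume "d \<in> D2" "d' \<in> D2"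
    then show "d \<noteq> d' + 3 * int m" using int_m by (auto dest!: D2; presburger)
  qed
  have g: "int (3 * i * m + 2 * j * m + 8 * k) \<in> int ` GGS_semigroup m" if "i \<le> 1" "j \<le> 3" for i j k
    using that unfolding GGS_semigroup_def by blast
  have coord: "\<exists>e\<in>A. \<exists>h\<le>1::nat. d = e + int h * c" if "d \<in> A \<union> (\<lambda>d. d + c) ` A" for A c d
    using that
  proof
    assume "d \<in> A"
    then show ?thesis by (intro bexI[of _ d] exI[of _ 0]) auto
  next
    assume "d \<in> (\<lambda>d. d + c) ` A"
    then show ?thesis by (auto intro!: exI[of _ 1])
  qed
  have "D3 \<subseteq> int ` GGS_semigroup m"
  proof
    fix d assume "d \<in> D3"
    then obtain e3 and h3 :: nat where 3: "e3 \<in> D2" "h3 \<le> 1" "d = e3 + int h3 * (3 * int m)"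
      unfolding D3_def using coord by metis
    then obtain e2 and h2 :: nat where 2: "e2 \<in> D1" "h2 \<le> 1" "e3 = e2 + int h2 * (2 * int m)"
      unfolding D2_def using coord by metis
    then obtain e1 and h1 :: nat where 1: "e1 \<in> D" "h1 \<le> 1" "e2 = e1 + int h1 * (4 * int m)"
      unfolding D1_def using coord by metis
    then obtain k where k: "e1 = 8 * int k" by (auto simp: D_def)
    \<comment> \<open>\<open>h1\<close> and \<open>h2\<close> are the binary digits of
      \<open>j\<close>, and \<open>h3\<close> is \<open>i\<close>.\<close>
    have "d = int (3 * h3 * m + 2 * (h2 + 2 * h1) * m + 8 * k)"
      by (simp add: 3 2 1 k algebra_simps)
    moreover have "h3 \<le> 1" "h2 + 2 * h1 \<le> 3" using 1(2) 2(2) 3(2) by auto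
    ultimately show "d \<in> int ` GGS_semigroup m" using g by metis
  qed
  then show ?thesis using 3 by blast
qed

section \<open>Uniqueness of the place at infinity and its discrete valuation\<close>

lemma infty_eq: "infty = {P}"
proof -
  have "Q = P" if Q: "Q \<in> infty" for Q
  proof (rule Set.set_eqI)
    fix f
    show "f \<in> Q \<longleftrightarrow> f \<in> P"
    proof (cases "f = 0")
      case True
      then show ?thesis using Q P_in_infty val_ring_infty val_ring_subring subring_0 by metis
    next
      case False
      \<comment> \<open>Membership is decided by the sign of the pole order, which is the same for
        all members of \<open>infty\<close>.\<close>
      then show ?thesis using pole_order_exists pole_order_in_iff Q P_in_infty by metis
    qed
  qed
  then show ?thesis using P_in_infty by blast
qed

lemma pole_order_t: "pole_order t (- 1)"
  using t_nonzero subring_1[OF val_ring_subring[OF val_rings]]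
  by (simp add: pole_order_def place_units_def power_int_minus)

lemma unit_iff_pole_order:
  assumes "pole_order f e"
  shows "f \<in> place_units P \<longleftrightarrow> e = 0"
  using pole_order_in_iff[OF assms P_in_infty] pole_order_nonzero[OF assms]
    pole_order_in_iff[OF pole_order_inverse[OF assms] P_in_infty]
  by (auto simp: place_units_def)

lemma is_uniformizer_of_pole_order:
  assumes "pole_order u (- 1)"
  shows "is_uniformizer P u"
  unfolding is_uniformizer_def
proof (intro Set.set_eqI iffI)
  note S = val_ring_subring[OF val_rings[OF P_in_infty]]
  note u0 = pole_order_nonzero[OF assms]
  fix f
  {
    assume f: "f \<in> P - place_units P"
    have "inverse u * f \<in> P"
    proof (cases "f = 0")
      case True
      then show ?thesis using subring_0[OF S] by simp
    next
      case False
      then obtain e where e: "pole_order f e" using pole_order_exists by blast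
      then have "e \<le> 0" "e \<noteq> 0"
        using f pole_order_in_iff[OF e P_in_infty] unit_iff_pole_order[OF e] by auto
      then show ?thesis
        using pole_order_in_iff[OF pole_order_mult[OF pole_order_inverse[OF assms] e] P_in_infty] by simp
    qed
    moreover have "f = u * (inverse u * f)" using u0 by simp
    ultimately show "f \<in> {u * h |h. h \<in> P}" by blast
  }
  assume "f \<in> {u * h |h. h \<in> P}"
  then obtain h where h: "f = u * h" "h \<in> P" by blast
  show "f \<in> P - place_units P"
  proof (cases "h = 0")
    case True
    then show ?thesis using h by (simp add: place_units_def)
  next
    case False
    then obtain e where e: "pole_order h e" using pole_order_exists by blast
    then have "e \<le> 0" using h pole_order_in_iff[OF e P_in_infty] by simp
    moreover have f: "pole_order f (- 1 + e)" unfolding h(1) using assms e by (rule pole_order_mult)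
    ultimately show ?thesis
      using pole_order_in_iff[OF f P_in_infty] unit_iff_pole_order[OF f] by simp
  qed
qed

lemma pole_order_powi: "pole_order f e \<Longrightarrow> pole_order (f powi i) (i * e)"
  using pole_order_power[of f e "nat i"] pole_order_inverse[OF pole_order_power[of f e "nat (- i)"]]
  by (auto simp: power_int_def power_inverse)

text \<open>\<open>t\<close> is a multiple \<open>u * h\<close> with \<open>h \<in> P\<close>, and
  an order of -1 cannot be split further because the order of \<open>u\<close> is already
  negative.\<close>

lemma uniformizer_pole_order:
  assumes "is_uniformizer P u"
  shows "pole_order u (- 1)"
proof -
  note S = val_ring_subring[OF val_rings[OF P_in_infty]]
  have P: "P - place_units P = {u * h |h. h \<in> P}" using assms by (simp add: is_uniformizer_def)
  have "t \<in> P - place_units P"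
    using unit_iff_pole_order[OF pole_order_t] pole_order_in_iff[OF pole_order_t P_in_infty] by simp
  then obtain h where h: "t = u * h" "h \<in> P" unfolding P by blast
  have uP: "u \<in> P - place_units P" unfolding P using subring_1[OF S] by force
  have n: "u \<noteq> 0" "h \<noteq> 0" using h t_nonzero by auto
  obtain e d where ed: "pole_order u e" "pole_order h d" using n pole_order_exists by blast
  have "e \<le> 0" "e \<noteq> 0" "d \<le> 0"
    using uP h(2) unit_iff_pole_order[OF ed(1)] ed[THEN pole_order_in_iff, OF P_in_infty] by auto
  moreover have "e + d = - 1"
  proof (rule pole_order_unique[OF pole_order_mult[OF ed]])
    show "pole_order (u * h) (- 1)" by (subst h(1)[symmetric]) (rule pole_order_t)
  qed
  ultimately have "e = - 1" by linarith
  then show ?thesis using ed(1) by simp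
qed

text \<open>The definite description is legitimate since \<open>t\<close> provides an exponent and
  all uniformizers have the same pole order.\<close>

lemma place_ord_eq:
  assumes f: "pole_order f e"
  shows "place_ord P f = - e"
  unfolding place_ord_def
proof (rule the_equality)
  have "f = t powi (- e) * (f * t powi e)"
    using t_nonzero by (simp add: mult.left_commute flip: power_int_add)
  moreover have "f * t powi e \<in> place_units P" using f P_in_infty by (auto simp: pole_order_def)
  ultimately show "\<exists>u v. is_uniformizer P u \<and> v \<in> place_units P \<and> f = u powi (- e) * v"
    using is_uniformizer_of_pole_order[OF pole_order_t] by blast
next
  fix i assume "\<exists>u v. is_uniformizer P u \<and> v \<in> place_units P \<and> f = u powi i * v"
  then obtain u v where uv: "is_uniformizer P u" "v \<in> place_units P" "f = u powi i * v" by blast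
  have "v \<noteq> 0" using uv(2) by (simp add: place_units_def)
  then obtain d where d: "pole_order v d" using pole_order_exists by blast
  then have "d = 0" using unit_iff_pole_order uv(2) by simp
  then have "pole_order f (i * - 1 + 0)"
    unfolding uv(3) using d uniformizer_pole_order[OF uv(1)] by (intro pole_order_mult pole_order_powi) auto
  then show "i = - e" using pole_order_unique[OF f] by fastforce
qed

text \<open>Regularity away from \<open>P\<close> means integrality over \<open>K[z]\<close>, which
  restricts the pole orders; conversely, the monomials in \<open>x, y, z\<close> realise every
  element.\<close>

theorem weierstrass_semigroup_eq: "weierstrass_semigroup K P = GGS_semigroup m"
proof (intro Set.set_eqI iffI)
  fix r assume "r \<in> weierstrass_semigroup K P"
  then obtain f where f: "f \<noteq> 0" "nat (- place_ord P f) = r" "\<And>Q. Q \<in> places K \<Longrightarrow> Q \<noteq> P \<Longrightarrow> f \<in> Q"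
    by (auto simp: weierstrass_semigroup_def has_pole_divisor_def)
  have zP: "z \<notin> P" and KP: "K \<subseteq> P" using P_in_infty by (auto simp: infty_def)
  \<comment> \<open>A valuation ring above \<open>R\<close> contains \<open>z\<close>, hence differs
    from \<open>P\<close> and is strictly larger than \<open>K\<close>; it is a place unless it is
    the whole field.\<close>
  have "f \<in> integral_closure R"
    unfolding integral_closure_def
  proof (intro CollectI allI impI)
    fix Q assume Q: "val_ring Q" "R \<subseteq> Q"
    then have *: "K \<subseteq> Q" "z \<in> Q" using adjoin_subset_iff by auto
    show "f \<in> Q"
    proof (cases "Q = UNIV")
      case False
      then have "Q \<in> places K" using Q * zP KP by (auto simp: places_iff)
      then show ?thesis using f(3) * zP by blast
    qed simp
  qed
  then obtain d where d: "d \<in> GGS_semigroup m" "pole_order f (int d)"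
    using integral_closure_subset pole_order_R3 f(1) by blast
  then show "r \<in> GGS_semigroup m" using f(2) place_ord_eq by simp
next
  fix r assume "r \<in> GGS_semigroup m"
  then obtain i j k where r: "r = 3 * i * m + 2 * j * m + 8 * k" by (auto simp: GGS_semigroup_def)
  let ?f = "x ^ i * y ^ j * z ^ k"
  have "pole_order ?f (int i * (3 * int m) + int j * (2 * int m) + int k * 8)"
    by (intro pole_order_mult pole_order_power pole_order_x pole_order_y pole_order_z)
  also have "int i * (3 * int m) + int j * (2 * int m) + int k * 8 = int r" by (simp add: r algebra_simps)
  finally have f: "pole_order ?f (int r)" .
  have "?f \<in> Q" if Q: "Q \<in> places K" "Q \<noteq> P" for Q
  proof -
    have V: "val_ring Q" and "K \<subseteq> Q" using Q by (auto simp: places_iff)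
    then have "z \<in> Q" using infty_eq Q by (auto simp: infty_def)
    then show ?thesis
      using coordinates_in_val_ring[OF V] val_ring_subring[OF V]
      by (intro subring_mult subring_power) auto
  qed
  then have "has_pole_divisor K ?f r P"
    using place_ord_eq[OF f] pole_order_nonzero[OF f] by (simp add: has_pole_divisor_def)
  then show "r \<in> weierstrass_semigroup K P" by (auto simp: weierstrass_semigroup_def)
qed

end

lemma weierstrass_semigroup_GGS:
  assumes "n \<ge> 3" and m: "3 * m = 2 ^ n + 1"
    and F: "GGS_function_field n m K x y z" and P: "place_at_infinity K x y z P"
  shows "weierstrass_semigroup K P = GGS_semigroup m"
proof -
  have "(2::nat) ^ n = 8 * 2 ^ (n - 3)" using power_add[of "2::nat" 3 "n - 3"] assms(1) by simp
  \<comment> \<open>\<open>3 * m\<close> is 1 modulo 8, and 3 is its own inverse modulo 8.\<close>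
  then have "m = 8 * (m div 8) + 3" using m by presburger
  moreover have "(2::'a) = 0"
    using F char_2_of_card_subfield by (auto simp: GGS_function_field_def)
  ultimately interpret GGS_curve m "m div 8" K P x y z
    using F P by (intro GGS_curve.intro) (auto simp: GGS_function_field_def)
  show ?thesis by (rule weierstrass_semigroup_eq)
qed

section \<open>Counting decompositions in the semigroup\<close>

text \<open>The least element of the semigroup in each residue class modulo 8, for \<open>m\<close> congruent to 3.\<close>

definition apery :: "nat \<Rightarrow> nat \<Rightarrow> nat" where
  "apery m r = [0, 3 * m, 6 * m, 9 * m, 4 * m, 7 * m, 2 * m, 5 * m] ! r"

lemma apery_mod:
  assumes "m mod 8 = 3" "r < 8"
  shows "apery m r mod 8 = r"
proof -
  have "r \<in> {0,1,2,3,4,5,6,7}" using assms(2) by auto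
  then show ?thesis
    using assms(1) by (elim insertE emptyE) (simp_all add: apery_def, presburger+)
qed

lemma less_8_cases: "(r::nat) < 8 \<Longrightarrow> r \<in> {0,1,2,3,4,5,6,7}"
  by auto

text \<open>The eight pairs \<open>(i, j)\<close> give exactly the elements
  \<open>apery m r\<close>, one in each class modulo 8, and \<open>k\<close> runs upwards through
  the class.\<close>

lemma GGS_semigroup_iff:
  assumes m: "m mod 8 = 3"
  shows "a \<in> GGS_semigroup m \<longleftrightarrow> apery m (a mod 8) \<le> a"
proof
  assume "a \<in> GGS_semigroup m"
  then obtain i j k where a: "a = 3 * i * m + 2 * j * m + 8 * k" "i \<le> 1" "j \<le> 3"
    by (auto simp: GGS_semigroup_def)
  have "i \<in> {0,1}" "j \<in> {0,1,2,3}" using a by auto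
  then have "\<exists>r\<in>{0,1,2,3,4,5,6,7}. 3 * i * m + 2 * j * m = apery m r"
    by (elim insertE emptyE) (simp_all add: apery_def)
  then obtain r where "r \<in> {0,1,2,3,4,5,6,7}" and r: "3 * i * m + 2 * j * m = apery m r" by blast
  then have "r < 8" by auto
  have "a mod 8 = r" using apery_mod[OF m \<open>r < 8\<close>] a(1) r by simp
  then show "apery m (a mod 8) \<le> a" using a(1) r by simp
next
  assume le: "apery m (a mod 8) \<le> a"
  define r where "r = a mod 8"
  have "r < 8" by (simp add: r_def)
  then have "(a - apery m r) mod 8 = 0"
    using apery_mod[OF m, of r] le by (metis r_def mod_eq_dvd_iff_nat mod_0_imp_dvd dvd_imp_mod_0)
  then obtain k where k: "a = apery m r + 8 * k"
    using le by (metis r_def le_add_diff_inverse mod_0_imp_dvd dvdE)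
  have "r \<in> {0,1,2,3,4,5,6,7}" using \<open>r < 8\<close> by auto
  then have "\<exists>i j. i \<le> 1 \<and> j \<le> 3 \<and> apery m r = 3 * i * m + 2 * j * m"
  proof (elim insertE emptyE)
    assume "r = 0" then show ?thesis by (intro exI[of _ 0]) (simp add: apery_def)
  next
    assume "r = 1" then show ?thesis by (intro exI[of _ 1] exI[of _ 0]) (simp add: apery_def)
  next
    assume "r = 2" then show ?thesis by (intro exI[of _ 0] exI[of _ 3]) (simp add: apery_def)
  next
    assume "r = 3" then show ?thesis by (intro exI[of _ 1] exI[of _ 3]) (simp add: apery_def)
  next
    assume "r = 4" then show ?thesis by (intro exI[of _ 0] exI[of _ 2]) (simp add: apery_def)
  next
    assume "r = 5" then show ?thesis by (intro exI[of _ 1] exI[of _ 2]) (simp add: apery_def)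
  next
    assume "r = 6" then show ?thesis by (intro exI[of _ 0] exI[of _ 1]) (simp add: apery_def)
  next
    assume "r = 7" then show ?thesis by (intro exI[of _ 1] exI[of _ 1]) (simp add: apery_def)
  qed
  then show "a \<in> GGS_semigroup m" unfolding k GGS_semigroup_def by (metis (mono_tags, lifting) mem_Collect_eq)
qed

section \<open>The number of decompositions as a piecewise linear function\<close>

definition decompositions :: "nat set \<Rightarrow> nat \<Rightarrow> (nat \<times> nat) set" where
  "decompositions H s = {(a, b). a \<in> H \<and> b \<in> H \<and> a + b = s}"

text \<open>If \<open>s\<close> is less than the sum of the two Apery elements, then by at least 8, and the
  truncated difference gives the correct count 0.\<close>

lemma card_decompositions:
  assumes m: "m mod 8 = 3"
  shows "card (decompositions (GGS_semigroup m) s) =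
    (\<Sum>r<8. (s + 8 - (apery m r + apery m ((s + 8 - r) mod 8))) div 8)"
proof -
  let ?D = "decompositions (GGS_semigroup m) s"
  have fin: "finite ?D"
    by (rule finite_subset[of _ "{..s} \<times> {..s}"]) (auto simp: decompositions_def)
  \<comment> \<open>Pairs are grouped by the residue \<open>r\<close> of the first summand, which
    fixes that of the second; the extra 8 keeps \<open>s + 8 - r\<close> from being
    truncated.\<close>
  have c: "card {p \<in> ?D. fst p mod 8 = r} =
      (s + 8 - (apery m r + apery m ((s + 8 - r) mod 8))) div 8" if r: "r < 8" for r
  proof -
    define A B where "A = apery m r" and "B = apery m ((s + 8 - r) mod 8)"
    have A: "A mod 8 = r" and B: "B mod 8 = (s + 8 - r) mod 8"
      using apery_mod[OF m] r by (simp_all add: A_def B_def)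
    have mods: "b mod 8 = (s + 8 - r) mod 8" if "a + b = s" "a mod 8 = r" for a b
    proof -
      have "a = 8 * (a div 8) + r" using that(2) by (metis mult_div_mod_eq)
      then obtain c where "a = 8 * c + r" by blast
      then have "s + 8 - r = b + 8 * (c + 1)" using that(1) by simp
      then show ?thesis by (simp only: mod_mult_self2)
    qed
    have "{p \<in> ?D. fst p mod 8 = r} = (\<lambda>k. (A + 8 * k, s - (A + 8 * k))) ` {k. A + B + 8 * k \<le> s}"
    proof (intro equalityI subsetI)
      fix p assume "p \<in> {p \<in> ?D. fst p mod 8 = r}"
      then obtain a b where p: "p = (a, b)" "a \<in> GGS_semigroup m" "b \<in> GGS_semigroup m"
          "a + b = s" "a mod 8 = r"
        unfolding decompositions_def by auto
      then have "apery m (a mod 8) \<le> a" "apery m (b mod 8) \<le> b"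
        using GGS_semigroup_iff[OF m] by auto
      then have le: "A \<le> a" "B \<le> b" using mods[of a b] p by (auto simp: A_def B_def)
      obtain k where k: "a = A + 8 * k" using le(1) p(5) A
        by (metis mod_eq_nat1E)
      then show "p \<in> (\<lambda>k. (A + 8 * k, s - (A + 8 * k))) ` {k. A + B + 8 * k \<le> s}"
        using p le by auto
    next
      fix p assume "p \<in> (\<lambda>k. (A + 8 * k, s - (A + 8 * k))) ` {k. A + B + 8 * k \<le> s}"
      then obtain k where k: "p = (A + 8 * k, s - (A + 8 * k))" "A + B + 8 * k \<le> s" by blast
      have a: "(A + 8 * k) mod 8 = r" using A by simp
      have b: "(s - (A + 8 * k)) mod 8 = (s + 8 - r) mod 8" using mods[OF _ a] k(2) by simp
      have "apery m ((A + 8 * k) mod 8) = A" by (simp only: a A_def[symmetric])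
      moreover have "apery m ((s - (A + 8 * k)) mod 8) = B" by (simp only: b B_def[symmetric])
      ultimately show "p \<in> {p \<in> ?D. fst p mod 8 = r}"
        using k a by (simp add: decompositions_def GGS_semigroup_iff[OF m])
    qed
    moreover have "inj_on (\<lambda>k. (A + 8 * k, s - (A + 8 * k))) {k. A + B + 8 * k \<le> s}"
      by (auto intro: inj_onI)
    ultimately have "card {p \<in> ?D. fst p mod 8 = r} = card {k. A + B + 8 * k \<le> s}"
      by (simp add: card_image)
    also have "{k. A + B + 8 * k \<le> s} = {..<(s + 8 - (A + B)) div 8}"
      by auto
    finally show ?thesis by (simp add: A_def B_def)
  qed
  have "card ?D = (\<Sum>r<8. card {p \<in> ?D. fst p mod 8 = r})"
    using sum.group[OF fin, of "{..<8}" "\<lambda>p. fst p mod 8" "\<lambda>_. 1 :: nat"] by fastforce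
  then show ?thesis using c by simp
qed

text \<open>\<open>apery 1\<close> lists the coefficients of \<open>m\<close>, so two Apery elements
  sum to \<open>u * m = 8 * u * q + 3 * u\<close>, where \<open>3 * u\<close> has residue
  \<open>\<rho>\<close>. The remaining division involves constants only, and each summand is a
  truncated linear function of \<open>w\<close> and \<open>q\<close>.\<close>

lemma card_decompositions_residue:
  assumes m: "m = 8 * q + 3" and \<rho>: "\<rho> < 8"
  shows "card (decompositions (GGS_semigroup m) (8 * w + \<rho>)) =
    (\<Sum>r<8. let u = apery 1 r + apery 1 ((\<rho> + 8 - r) mod 8) in w + 1 - (u * q + (3 * u - \<rho>) div 8))"
proof -
  have "(8 * w + \<rho> + 8 - (apery m r + apery m ((8 * w + \<rho> + 8 - r) mod 8))) div 8 =
      (let u = apery 1 r + apery 1 ((\<rho> + 8 - r) mod 8) in w + 1 - (u * q + (3 * u - \<rho>) div 8))"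
    if r: "r < 8" for r
  proof -
    define r' where "r' = (\<rho> + 8 - r) mod 8"
    define u where "u = apery 1 r + apery 1 r'"
    have apery_m: "apery m i = apery 1 i * m" if "i < 8" for i
      using less_8_cases[OF that] by (elim insertE emptyE) (simp_all add: apery_def)
    have apery_1: "3 * apery 1 i mod 8 = i" if "i < 8" for i
      using less_8_cases[OF that] by (elim insertE emptyE) (simp_all add: apery_def)
    have r': "(8 * w + \<rho> + 8 - r) mod 8 = r'" proof -
      have "8 * w + \<rho> + 8 - r = \<rho> + 8 - r + 8 * w" using r by simp
      then show ?thesis by (simp only: mod_mult_self2 r'_def)
    qed
    have "r' < 8" by (simp add: r'_def)
    have "(3 * u) mod 8 = (r + r') mod 8"
      using mod_add_eq[of "3 * apery 1 r" 8 "3 * apery 1 r'"] apery_1[OF r] apery_1[OF \<open>r' < 8\<close>]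
      by (simp add: u_def distrib_left)
    also have "\<dots> = \<rho>" using r \<rho> by (simp add: r'_def mod_add_right_eq)
    finally obtain j where j: "3 * u = 8 * j + \<rho>" by (metis mult_div_mod_eq)
    have "apery m r + apery m r' = u * m"
      using apery_m[OF r] apery_m[OF \<open>r' < 8\<close>] by (simp add: u_def distrib_right)
    also have "\<dots> = 8 * (u * q) + 3 * u" by (simp add: m algebra_simps)
    finally have "8 * w + \<rho> + 8 - (apery m r + apery m r') = 8 * (w + 1 - (u * q + j))"
      unfolding j by (simp add: diff_mult_distrib2)
    moreover have "(3 * u - \<rho>) div 8 = j" using j by simp
    ultimately show ?thesis
      unfolding r' Let_def r'_def[symmetric] u_def[symmetric] by simp
  qed
  moreover have "m mod 8 = 3" by (simp add: m)
  ultimately show ?thesis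
    unfolding card_decompositions[OF \<open>m mod 8 = 3\<close>]
    by (intro sum.cong) (simp_all only: lessThan_iff)
qed

lemma sum_lessThan_8: "(\<Sum>r<8. f r) = f 0 + f 1 + f 2 + f 3 + f 4 + f 5 + f 6 + (f 7 :: nat)"
  for f :: "nat \<Rightarrow> nat"
  by (simp add: numeral_eq_Suc)

lemmas residue_simps = card_decompositions_residue sum_lessThan_8 apery_def Let_def

text \<open>Here \<open>v\<close> is the claimed minimum in the three ranges of \<open>k\<close>. In
  each residue class of \<open>s\<close> the bound is linear arithmetic in \<open>q\<close>,
  \<open>k\<close>, \<open>w\<close> and \<open>v\<close>.\<close>

lemma card_decompositions_lower:
  assumes m: "m = 8 * q + 3" and k: "m \<le> k" "8 * k + 14 < 16 * m" and s: "2 * m + 8 * k \<le> s"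
    and v: "(8 * k + 11 < 9 * m \<and> v = 8 * k + 13 - 7 * m) \<or>
       (9 * m \<le> 8 * k + 11 \<and> 8 * k + 9 < 11 * m \<and> v = 8 * k + 11 - 7 * m) \<or>
       (11 * m \<le> 8 * k + 9 \<and> v = 8 * k + 9 - 7 * m)"
  shows "v \<le> card (decompositions (GGS_semigroup m) s)"
proof -
  define w \<rho> where "w = s div 8" and "\<rho> = s mod 8"
  have s8: "s = 8 * w + \<rho>" and \<rho>: "\<rho> < 8" by (simp_all add: w_def \<rho>_def)
  \<comment> \<open>\<open>2 * m + 8 * k\<close> is \<open>8 * (2 * q + k) + 6\<close>, so residues
    6 and 7 allow a smaller quotient by one.\<close>
  have w: "if \<rho> < 6 then 2 * q + k + 1 \<le> w else 2 * q + k \<le> w"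
    using s unfolding s8 m using \<rho> by auto
  have v': "(k \<le> 9 * q + 1 \<and> v + 56 * q + 8 = 8 * k) \<or>
     (9 * q + 2 \<le> k \<and> k \<le> 11 * q + 2 \<and> v + 56 * q + 10 = 8 * k) \<or>
     (11 * q + 3 \<le> k \<and> v + 56 * q + 12 = 8 * k)"
    using v k unfolding m by auto
  have k': "8 * q + 3 \<le> k" "k \<le> 16 * q + 4" using k unfolding m by auto
  show ?thesis
    unfolding s8
    using less_8_cases[OF \<rho>] w v' k'
    by (elim insertE emptyE; simp only: card_decompositions_residue[OF m];
        simp add: residue_simps del: One_nat_def; linarith)
qed

text \<open>The bounds of \<open>card_decompositions_lower\<close> are attained at these elements,
  which lie in the classes 3, 1 and 7 modulo 8.\<close>

lemma card_decompositions_values: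
  assumes m: "m = 8 * q + 3" and k: "m \<le> k" "8 * k + 14 < 16 * m"
  shows "8 * k + 11 < 9 * m \<Longrightarrow>
      card (decompositions (GGS_semigroup m) (2 * m + 8 * k + 5)) = 8 * k + 13 - 7 * m"
    and "9 * m \<le> 8 * k + 11 \<Longrightarrow> 8 * k + 9 < 11 * m \<Longrightarrow>
      card (decompositions (GGS_semigroup m) (2 * m + 8 * k + 3)) = 8 * k + 11 - 7 * m"
    and "11 * m \<le> 8 * k + 9 \<Longrightarrow>
      card (decompositions (GGS_semigroup m) (2 * m + 8 * k + 1)) = 8 * k + 9 - 7 * m"
proof -
  have s: "2 * m + 8 * k + 5 = 8 * (2 * q + k + 1) + 3" "2 * m + 8 * k + 3 = 8 * (2 * q + k + 1) + 1"
    "2 * m + 8 * k + 1 = 8 * (2 * q + k) + 7" by (simp_all add: m)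
  show "8 * k + 11 < 9 * m \<Longrightarrow>
      card (decompositions (GGS_semigroup m) (2 * m + 8 * k + 5)) = 8 * k + 13 - 7 * m"
    unfolding s using k
    by (simp only: card_decompositions_residue[OF m])
      (simp add: residue_simps m del: One_nat_def)
  show "9 * m \<le> 8 * k + 11 \<Longrightarrow> 8 * k + 9 < 11 * m \<Longrightarrow>
      card (decompositions (GGS_semigroup m) (2 * m + 8 * k + 3)) = 8 * k + 11 - 7 * m"
    unfolding s using k
    by (simp only: card_decompositions_residue[OF m])
      (simp add: residue_simps m del: One_nat_def; linarith)
  show "11 * m \<le> 8 * k + 9 \<Longrightarrow>
      card (decompositions (GGS_semigroup m) (2 * m + 8 * k + 1)) = 8 * k + 9 - 7 * m"
    unfolding s using k
    by (simp only: card_decompositions_residue[OF m])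
      (simp add: residue_simps m del: One_nat_def; linarith)
qed

section \<open>From decompositions to the order bound\<close>

lemma enumerate_consecutive:
  assumes "infinite H" "enumerate H l = s" "\<And>a. s \<le> a \<Longrightarrow> a \<in> H"
  shows "enumerate H (l + d) = s + (d::nat)"
proof (induction d)
  case (Suc d)
  have "enumerate H (Suc (l + d)) = (LEAST a. a \<in> H \<and> s + d < a)"
    using enumerate_Suc''[OF assms(1)] Suc by simp
  also have "\<dots> = s + Suc d" using assms(3) by (intro Least_equality) auto
  finally show ?case by simp
qed (use assms in simp)

lemma d_ORD_eq:
  assumes "l \<le> r" "\<And>r'. l \<le> r' \<Longrightarrow> nu H r \<le> nu H r'"
  shows "d_ORD H l = nu H r"
  unfolding d_ORD_def by (rule cInf_eq_minimum) (use assms in auto)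

theorem proposition3p16:
  fixes n m g k l :: nat
    and K Pinf :: "'a::field set"
    and x y z :: 'a
    and H :: "nat set"
  assumes "n \<ge> 5" and "odd n"
    and "real m = (2 ^ n + 1) / 3"
    and "real g = (9 * real m - 7) / 2"
    and "GGS_function_field n m K x y z"
    and "place_at_infinity K x y z Pinf"
    and "H = weierstrass_semigroup K Pinf"
    and "l \<ge> 1"
    and "rho H l > 2 * g"
    and "rho H (l + 1) = 2 * m + 8 * k"
    and "2 * m + 8 * k < 4 * g"
    and "m \<le> k" and "k < 2 * m"
  shows "(real k < (9 * real m - 11) / 8 \<longrightarrow>
            d_ORD H l = nu H (l + 5) \<and>
            int (nu H (l + 5)) = 8 * int k - 7 * int m + 13)
       \<and> ((9 * real m - 11) / 8 \<le> real k \<and> real k < (11 * real m - 9) / 8 \<longrightarrow>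
            d_ORD H l = nu H (l + 3) \<and>
            int (nu H (l + 3)) = 8 * int k - 7 * int m + 11)
       \<and> (real k \<ge> (11 * real m - 9) / 8 \<longrightarrow>
            d_ORD H l = nu H (l + 1) \<and>
            int (nu H (l + 1)) = 8 * int k - 7 * int m + 9)"
proof -
  have "real (3 * m) = real (2 ^ n + 1)" using assms(3) by simp
  then have m3: "3 * m = 2 ^ n + 1" by (simp only: of_nat_eq_iff)
  have "real (2 * g + 7) = real (9 * m)" using assms(4) by simp
  then have g: "2 * g + 7 = 9 * m" by (simp only: of_nat_eq_iff)
  have H: "H = GGS_semigroup m"
    using weierstrass_semigroup_GGS[OF _ m3 assms(5,6)] assms(1,7) by simp
  have "(2::nat) ^ n = 8 * 2 ^ (n - 3)" using power_add[of "2::nat" 3 "n - 3"] assms(1) by simp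
  then have m8: "m mod 8 = 3" using m3 by presburger
  then obtain q where q: "m = 8 * q + 3" by (metis mult_div_mod_eq)
  \<comment> \<open>The second part is \<open>2 * m + 8 * k < 4 * g\<close> with
    \<open>4 * g = 18 * m - 14\<close>.\<close>
  have k: "m \<le> k" "8 * k + 14 < 16 * m" using assms(11,12) g by auto
  define s where "s = 2 * m + 8 * k"
  \<comment> \<open>The largest Apery element is \<open>9 * m\<close>, while \<open>s\<close> is at
    least \<open>10 * m\<close>: there are no gaps from \<open>s\<close> on.\<close>
  have sH: "a \<in> H" if "s \<le> a" for a
  proof -
    have "apery m (a mod 8) \<le> 9 * m"
    proof -
      have "a mod 8 < 8" by simp
      then show ?thesis
        by (rule less_8_cases[elim_format], elim insertE emptyE) (simp_all add: apery_def)
    qed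
    also have "\<dots> \<le> a" using that k by (simp add: s_def)
    finally show ?thesis using GGS_semigroup_iff[OF m8] H by simp
  qed
  then have inf: "infinite H" by (metis infinite_nat_iff_unbounded_le nle_le)
  \<comment> \<open>\<open>rho\<close> counts from 1 and \<open>enumerate\<close> from 0, so
    \<open>rho H (l + 1)\<close> is \<open>enumerate H l\<close>.\<close>
  have enum: "enumerate H l = s" using assms(10) by (simp add: rho_def s_def)
  have nu: "nu H r = card (decompositions (GGS_semigroup m) (enumerate H r))" for r
    by (simp add: nu_def rho_def decompositions_def H)
  \<comment> \<open>Since consecutive integers follow \<open>s\<close> in \<open>H\<close>, raising
    the index by \<open>d\<close> raises the element by \<open>d\<close>.\<close>
  have nu_d: "nu H (l + d) = card (decompositions (GGS_semigroup m) (2 * m + 8 * k + d))" for d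
    using enumerate_consecutive[OF inf enum sH] by (simp add: nu s_def)
  have ge: "2 * m + 8 * k \<le> enumerate H r" if "l \<le> r" for r
    using enumerate_mono_le_iff[OF inf] that enum unfolding s_def by metis
  note lower = card_decompositions_lower[OF q k ge, folded nu]
  note val = card_decompositions_values[OF q k]
  \<comment> \<open>Clearing denominators turns the real case distinction into the one over the
    naturals, with subtraction moved to the other side.\<close>
  have cmp: "real k < (real a * real m - real b) / 8 \<longleftrightarrow> 8 * k + b < a * m" for a b
  proof -
    have "real k < (real a * real m - real b) / 8 \<longleftrightarrow> real (8 * k + b) < real (a * m)"
      by (simp add: field_simps)
    then show ?thesis by (simp only: of_nat_less_iff)
  qed
  have k9: "real k < (9 * real m - 11) / 8 \<longleftrightarrow> 8 * k + 11 < 9 * m"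
    and k11: "real k < (11 * real m - 9) / 8 \<longleftrightarrow> 8 * k + 9 < 11 * m"
    using cmp[of 9 11] cmp[of 11 9] by simp_all
  show ?thesis
  proof (intro conjI impI; (elim conjE)?)
    assume "real k < (9 * real m - 11) / 8"
    then have c: "8 * k + 11 < 9 * m" using k9 by blast
    have v: "nu H (l + 5) = 8 * k + 13 - 7 * m" by (simp only: nu_d val(1)[OF c])
    then show "int (nu H (l + 5)) = 8 * int k - 7 * int m + 13" using k by linarith
    show "d_ORD H l = nu H (l + 5)"
      by (rule d_ORD_eq, simp, unfold v, rule lower) (use c in auto)
  next
    assume "(9 * real m - 11) / 8 \<le> real k" "real k < (11 * real m - 9) / 8"
    then have c: "9 * m \<le> 8 * k + 11" "8 * k + 9 < 11 * m" using k9 k11 by linarith+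
    have v: "nu H (l + 3) = 8 * k + 11 - 7 * m" by (simp only: nu_d val(2)[OF c])
    then show "int (nu H (l + 3)) = 8 * int k - 7 * int m + 11" using k by linarith
    show "d_ORD H l = nu H (l + 3)"
      by (rule d_ORD_eq, simp, unfold v, rule lower) (use c in auto)
  next
    assume "real k \<ge> (11 * real m - 9) / 8"
    then have c: "11 * m \<le> 8 * k + 9" using k11 by linarith
    have v: "nu H (l + 1) = 8 * k + 9 - 7 * m" by (simp only: nu_d val(3)[OF c])
    then show "int (nu H (l + 1)) = 8 * int k - 7 * int m + 9" using k by linarith
    show "d_ORD H l = nu H (l + 1)"
      by (rule d_ORD_eq, simp, unfold v, rule lower) (use c in auto)
  qed
qed

end
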